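(* Let $S\subset\mathbb{C}\mathbb{P}^2$ be a real conic-line arrangement consisting of two smooth conics which are tangent to each other at two points and up to two additional lines (i.e. zero, one or two lines, in any position). Then the fundamental group $\pi_1(\mathbb{C}\mathbb{P}^2-S)$ is big.
   Context: A group is called big if it contains a subgroup which is free on two or more generators. A real conic-line arrangement is a finite union of conics and lines in $\mathbb{C}\mathbb{P}^2$ defined by equations with real coefficients. *)

theory Defs
  imports "HOL-Analysis.Analysis" "HOL-Algebra.Generated_Groups"
begin

section \<open>The complex projective plane\<close>

definition proportional :: "complex^3 \<Rightarrow> complex^3 \<Rightarrow> bool" where
  "proportional z w \<longleftrightarrow> z \<noteq> 0 \<and> w \<noteq> 0 \<and> (\<exists>c. w = c *s z)"

lemma part_equivp_proportional: "part_equivp proportional"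
proof (rule part_equivpI)
  show "\<exists>z. proportional z z"
    by (rule exI[of _ 1]) (auto simp: proportional_def intro!: exI[of _ 1])
  show "symp proportional"
  proof (rule sympI)
    fix z w assume "proportional z w"
    then obtain c where c: "z \<noteq> 0" "w \<noteq> 0" "w = c *s z"
      by (auto simp: proportional_def)
    then have "c \<noteq> 0" by auto
    then have "z = inverse c *s w" by (simp add: c vector_smult_assoc)
    with c show "proportional w z" unfolding proportional_def by blast
  qed
  show "transp proportional"
    by (rule transpI) (auto simp: proportional_def vector_smult_assoc)
qed

quotient_type cp2 = "complex^3" / partial: proportional
  by (rule part_equivp_proportional)

text \<open>The quotient map \<open>abs_cp2\<close> is only meaningful on nonzero vectors, on which it sends
  \<open>(x, y, z)\<close> to \<open>[x : y : z]\<close>. All uses below are guarded accordingly.\<close>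

lemma abs_cp2_eq_iff:
  assumes "z \<noteq> 0" "w \<noteq> 0"
  shows "abs_cp2 z = abs_cp2 w \<longleftrightarrow> (\<exists>c. w = c *s z)"
proof -
  have "proportional z z" "proportional w w"
    using assms by (auto simp: proportional_def intro!: exI[of _ 1])
  then have "abs_cp2 z = abs_cp2 w \<longleftrightarrow> proportional z w"
    using Quotient3_rel[OF Quotient3_cp2] by blast
  then show ?thesis using assms by (simp add: proportional_def)
qed

lemma cp2_cases:
  obtains z where "z \<noteq> 0" "p = abs_cp2 z"
  using Quotient3_abs_rep[OF Quotient3_cp2, of p] Quotient3_rep_reflp[OF Quotient3_cp2, of p]
  by (metis proportional_def)

text \<open>The quotient topology; since the nonzero vectors form an open set, relative openness of the
  preimage in them is plain openness.\<close>

instantiation cp2 :: topological_space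
begin

definition open_cp2 :: "cp2 set \<Rightarrow> bool" where
  "open_cp2 U \<longleftrightarrow> open {z. z \<noteq> 0 \<and> abs_cp2 z \<in> U}"

instance
proof
  show "open (UNIV :: cp2 set)"
    unfolding open_cp2_def by (auto intro!: open_Collect_neq continuous_intros)
next
  fix U V :: "cp2 set" assume "open U" "open V"
  then have "open ({z. z \<noteq> 0 \<and> abs_cp2 z \<in> U} \<inter> {z. z \<noteq> 0 \<and> abs_cp2 z \<in> V})"
    unfolding open_cp2_def by (rule open_Int)
  also have "\<dots> = {z. z \<noteq> 0 \<and> abs_cp2 z \<in> U \<inter> V}" by auto
  finally show "open (U \<inter> V)" by (simp add: open_cp2_def)
next
  fix K :: "cp2 set set" assume "\<forall>U\<in>K. open U"
  then have "open (\<Union>U\<in>K. {z. z \<noteq> 0 \<and> abs_cp2 z \<in> U})"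
    unfolding open_cp2_def by blast
  also have "\<dots> = {z. z \<noteq> 0 \<and> abs_cp2 z \<in> \<Union>K}" by auto
  finally show "open (\<Union>K)" by (simp add: open_cp2_def)
qed

end

section \<open>Conics and lines\<close>

definition zero_locus :: "(complex^3 \<Rightarrow> complex) \<Rightarrow> cp2 set" where
  "zero_locus F = {abs_cp2 z | z. z \<noteq> 0 \<and> F z = 0}"

definition linear_form :: "complex^3 \<Rightarrow> complex^3 \<Rightarrow> complex" where
  "linear_form a z = (\<Sum>i\<in>UNIV. a $ i * z $ i)"

definition quadratic_form :: "complex^3^3 \<Rightarrow> complex^3 \<Rightarrow> complex" where
  "quadratic_form A z = (\<Sum>i\<in>UNIV. \<Sum>j\<in>UNIV. A $ i $ j * z $ i * z $ j)"

definition real_line :: "cp2 set \<Rightarrow> bool" where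
  "real_line L \<longleftrightarrow> (\<exists>a. a \<noteq> 0 \<and> (\<forall>i. a $ i \<in> \<real>) \<and> L = zero_locus (linear_form a))"

text \<open>By the symmetry of the coefficient matrix, \<open>A \<noteq> 0\<close> says that the quadratic form is not
  identically zero.\<close>

definition conic_equation :: "complex^3^3 \<Rightarrow> cp2 set \<Rightarrow> bool" where
  "conic_equation A C \<longleftrightarrow> transpose A = A \<and> A \<noteq> 0 \<and> C = zero_locus (quadratic_form A)"

definition real_conic :: "cp2 set \<Rightarrow> bool" where
  "real_conic C \<longleftrightarrow> (\<exists>A. conic_equation A C \<and> (\<forall>i j. A $ i $ j \<in> \<real>))"

text \<open>The two finite families consist of the components of the arrangement.\<close>

definition real_conic_line_arrangement :: "cp2 set set \<Rightarrow> cp2 set set \<Rightarrow> bool" where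
  "real_conic_line_arrangement Cs Ls \<longleftrightarrow>
     finite Cs \<and> finite Ls \<and> (\<forall>C\<in>Cs. real_conic C) \<and> (\<forall>L\<in>Ls. real_line L)"

text \<open>The vector of complex partial derivatives.\<close>

definition gradient :: "(complex^3 \<Rightarrow> complex) \<Rightarrow> complex^3 \<Rightarrow> complex^3" where
  "gradient F z = (\<chi> i. deriv (\<lambda>t. F (z + axis i t)) 0)"

definition smooth_conic_equation :: "complex^3^3 \<Rightarrow> cp2 set \<Rightarrow> bool" where
  "smooth_conic_equation A C \<longleftrightarrow> conic_equation A C \<and>
     (\<forall>z. z \<noteq> 0 \<and> quadratic_form A z = 0 \<longrightarrow> gradient (quadratic_form A) z \<noteq> 0)"

definition smooth_conic :: "cp2 set \<Rightarrow> bool" where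
  "smooth_conic C \<longleftrightarrow> (\<exists>A. smooth_conic_equation A C)"

text \<open>The projective tangent line at \<open>[z]\<close> of the curve \<open>F = 0\<close>, for a homogeneous \<open>F\<close> with
  \<open>F z = 0\<close> and nonzero gradient at \<open>z\<close>.\<close>

definition tangent_line :: "(complex^3 \<Rightarrow> complex) \<Rightarrow> complex^3 \<Rightarrow> cp2 set" where
  "tangent_line F z = zero_locus (linear_form (gradient F z))"

text \<open>A smooth conic determines its equation up to a nonzero scalar, so the choice of the
  equations is immaterial, as is that of the representative of the point.\<close>

definition tangent_at :: "cp2 set \<Rightarrow> cp2 set \<Rightarrow> cp2 \<Rightarrow> bool" where
  "tangent_at C D p \<longleftrightarrow> p \<in> C \<and> p \<in> D \<and>
     (\<exists>A B z. smooth_conic_equation A C \<and> smooth_conic_equation B D \<and> z \<noteq> 0 \<and> p = abs_cp2 z \<and>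
        tangent_line (quadratic_form A) z = tangent_line (quadratic_form B) z)"

lemma quadratic_form_scale: "quadratic_form A (c *s z) = c\<^sup>2 * quadratic_form A z"
  by (simp add: quadratic_form_def sum_distrib_left power2_eq_square ac_simps)

lemma linear_form_scale: "linear_form a (c *s z) = c * linear_form a z"
  by (simp add: linear_form_def sum_distrib_left ac_simps)

lemma abs_cp2_in_zero_locus_iff:
  assumes "\<And>c z. F (c *s z) = c ^ n * F z" "z \<noteq> 0"
  shows "abs_cp2 z \<in> zero_locus F \<longleftrightarrow> F z = 0"
proof
  assume "abs_cp2 z \<in> zero_locus F"
  then obtain w where w: "w \<noteq> 0" "F w = 0" "abs_cp2 w = abs_cp2 z"
    unfolding zero_locus_def by auto
  then obtain c where "z = c *s w" using abs_cp2_eq_iff assms(2) by blast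
  then show "F z = 0" by (simp add: assms(1) w)
qed (use assms(2) in \<open>auto simp: zero_locus_def\<close>)

lemma gradient_quadratic_form:
  assumes "transpose A = A"
  shows "gradient (quadratic_form A) z = 2 *s (A *v z)"
proof -
  have "((\<lambda>t. quadratic_form A (z + axis k t)) has_field_derivative (2 * (A *v z) $ k)) (at 0)"
    for k
  proof -
    have sym: "A $ i $ j = A $ j $ i" for i j
      using assms by (metis (no_types, lifting) transpose_def vec_lambda_beta)
    have eq: "quadratic_form A (z + axis k t) =
        quadratic_form A z + t * (2 * (A *v z) $ k) + t\<^sup>2 * A $ k $ k" for t
    proof -
      have ax: "axis k t $ i = (if i = k then t else 0)" for i
        by (simp add: axis_def)
      have "quadratic_form A (z + axis k t) = quadratic_form A z
          + (\<Sum>i\<in>UNIV. \<Sum>j\<in>UNIV. A $ i $ j * z $ i * axis k t $ j)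
          + (\<Sum>i\<in>UNIV. \<Sum>j\<in>UNIV. A $ i $ j * axis k t $ i * z $ j)
          + (\<Sum>i\<in>UNIV. \<Sum>j\<in>UNIV. A $ i $ j * axis k t $ i * axis k t $ j)"
        by (simp add: quadratic_form_def algebra_simps sum.distrib)
      also have "(\<Sum>i\<in>UNIV. \<Sum>j\<in>UNIV. A $ i $ j * z $ i * axis k t $ j) = t * (A *v z) $ k"
        by (simp add: ax matrix_vector_mult_def if_distrib sum_distrib_left sym ac_simps cong: if_cong)
      also have "(\<Sum>i\<in>UNIV. \<Sum>j\<in>UNIV. A $ i $ j * axis k t $ i * z $ j) = t * (A *v z) $ k"
        by (subst sum.swap)
          (simp add: ax matrix_vector_mult_def if_distrib if_distribR sum_distrib_left ac_simps
            cong: if_cong)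
      also have "(\<Sum>i\<in>UNIV. \<Sum>j\<in>UNIV. A $ i $ j * axis k t $ i * axis k t $ j) = t\<^sup>2 * A $ k $ k"
      proof -
        have "(\<Sum>j\<in>UNIV. A $ i $ j * axis k t $ i * axis k t $ j) =
            (if i = k then t\<^sup>2 * A $ k $ k else 0)" for i
          by (simp add: ax if_distrib power2_eq_square cong: if_cong)
        then show ?thesis by simp
      qed
      finally show ?thesis by (simp add: algebra_simps)
    qed
    show ?thesis unfolding eq by (auto intro!: derivative_eq_intros)
  qed
  then show ?thesis
    by (simp add: gradient_def vec_eq_iff DERIV_imp_deriv)
qed

section \<open>The fundamental group\<close>

definition loops :: "'a::topological_space set \<Rightarrow> 'a \<Rightarrow> (real \<Rightarrow> 'a) set" where
  "loops X x = {p. path p \<and> path_image p \<subseteq> X \<and> pathstart p = x \<and> pathfinish p = x}"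

definition loop_class :: "'a::topological_space set \<Rightarrow> (real \<Rightarrow> 'a) \<Rightarrow> (real \<Rightarrow> 'a) set" where
  "loop_class X p = {q. homotopic_paths X p q}"

definition fundamental_group ::
    "'a::topological_space set \<Rightarrow> 'a \<Rightarrow> (real \<Rightarrow> 'a) set monoid" where
  "fundamental_group X x =
     \<lparr>carrier = loop_class X ` loops X x,
      mult = (\<lambda>P Q. {r. \<exists>p\<in>P. \<exists>q\<in>Q. homotopic_paths X (p +++ q) r}),
      one = loop_class X (\<lambda>_. x)\<rparr>"

lemma loop_class_eq_iff:
  assumes "p \<in> loops X x"
  shows "loop_class X p = loop_class X q \<longleftrightarrow> homotopic_paths X p q"
proof
  have "p \<in> loop_class X p" using assms by (simp add: loop_class_def loops_def)
  then show "loop_class X p = loop_class X q \<Longrightarrow> homotopic_paths X p q"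
    by (auto simp: loop_class_def homotopic_paths_sym)
  show "homotopic_paths X p q \<Longrightarrow> loop_class X p = loop_class X q"
    unfolding loop_class_def using homotopic_paths_trans homotopic_paths_sym by blast
qed

lemma loops_join: "p \<in> loops X x \<Longrightarrow> q \<in> loops X x \<Longrightarrow> p +++ q \<in> loops X x"
  by (auto simp: loops_def path_image_join)

lemma loops_reversepath: "p \<in> loops X x \<Longrightarrow> reversepath p \<in> loops X x"
  by (auto simp: loops_def)

lemma loops_const: "x \<in> X \<Longrightarrow> (\<lambda>_. x) \<in> loops X x"
  by (auto simp: loops_def path_def path_image_def pathstart_def pathfinish_def)

lemma fundamental_group_mult:
  assumes "p \<in> loops X x" "q \<in> loops X x"
  shows "loop_class X p \<otimes>\<^bsub>fundamental_group X x\<^esub> loop_class X q = loop_class X (p +++ q)"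
proof -
  have "homotopic_paths X p p" "homotopic_paths X q q" "pathfinish p = pathstart q"
    using assms by (auto simp: loops_def)
  then have "(\<exists>p'\<in>loop_class X p. \<exists>q'\<in>loop_class X q. homotopic_paths X (p' +++ q') r)
      \<longleftrightarrow> homotopic_paths X (p +++ q) r" for r
    unfolding loop_class_def mem_Collect_eq Bex_def
    by (meson homotopic_paths_trans homotopic_paths_join)
  then show ?thesis
    by (simp add: fundamental_group_def loop_class_def)
qed

lemma homotopic_const_join:
  assumes "p \<in> loops X x"
  shows "homotopic_paths X ((\<lambda>_. x) +++ p) p"
proof (rule homotopic_paths_sym, rule homotopic_paths_reparametrize)
  show "path p" "path_image p \<subseteq> X" using assms by (auto simp: loops_def)
  let ?f = "\<lambda>t::real. max 0 (2 * t - 1)"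
  show "continuous_on {0..1} ?f" by (intro continuous_intros)
  show "((\<lambda>_. x) +++ p) t = p (?f t)" for t
  proof -
    have "p 0 = x" using assms by (simp add: loops_def pathstart_def)
    moreover have "?f t = (if t \<le> 1 / 2 then 0 else 2 * t - 1)" by auto
    ultimately show ?thesis by (simp add: joinpaths_def)
  qed
qed auto

lemma homotopic_reverse_join:
  assumes "p \<in> loops X x"
  shows "homotopic_paths X (reversepath p +++ p) (\<lambda>_. x)"
proof -
  have p: "continuous_on {0..1} p" "p ` {0..1} \<subseteq> X" "p 0 = x" "p 1 = x"
    using assms by (auto simp: loops_def path_def path_image_def pathstart_def pathfinish_def)
  let ?g = "\<lambda>u::real \<times> real. max (fst u) \<bar>1 - 2 * snd u\<bar>"
  have g: "?g u \<in> {0..1}" if "u \<in> {0..1} \<times> {0..1}" for u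
    using that by auto
  show ?thesis
    unfolding homotopic_paths
  proof (intro exI[of _ "\<lambda>u. p (?g u)"] conjI ballI)
    show "continuous_on ({0..1} \<times> {0..1}) (\<lambda>u. p (?g u))"
      by (rule continuous_on_compose2[OF p(1)]) (use g in \<open>auto intro!: continuous_intros\<close>)
    show "(\<lambda>u. p (?g u)) \<in> {0..1} \<times> {0..1} \<rightarrow> X"
      using g p(2) by blast
    fix t :: real assume t: "t \<in> {0..1}"
    then have m: "max 1 \<bar>1 - 2 * t\<bar> = 1" "max t 1 = 1" by auto
    show "p (?g (0, t)) = (reversepath p +++ p) t"
      using t by (auto simp: joinpaths_def reversepath_def max_def abs_if)
    show "p (?g (1, t)) = x"
      using m p(4) by simp
    show "pathstart ((\<lambda>u. p (?g u)) \<circ> Pair t) = pathstart (reversepath p +++ p)"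
      and "pathfinish ((\<lambda>u. p (?g u)) \<circ> Pair t) = pathfinish (reversepath p +++ p)"
      using m p by (simp_all add: pathstart_def pathfinish_def joinpaths_def reversepath_def)
  qed
qed

lemma group_fundamental_group:
  assumes "x \<in> X"
  shows "group (fundamental_group X x)"
proof (rule groupI)
  let ?G = "fundamental_group X x"
  have car: "carrier ?G = loop_class X ` loops X x" and one: "\<one>\<^bsub>?G\<^esub> = loop_class X (\<lambda>_. x)"
    by (simp_all add: fundamental_group_def)
  note mult = fundamental_group_mult
  show "P \<otimes>\<^bsub>?G\<^esub> Q \<in> carrier ?G" if "P \<in> carrier ?G" "Q \<in> carrier ?G" for P Q
    using that by (auto simp: car mult loops_join)
  show "\<one>\<^bsub>?G\<^esub> \<in> carrier ?G"
    using assms by (auto simp: car one loops_const)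
  show "P \<otimes>\<^bsub>?G\<^esub> Q \<otimes>\<^bsub>?G\<^esub> R = P \<otimes>\<^bsub>?G\<^esub> (Q \<otimes>\<^bsub>?G\<^esub> R)"
    if PQR: "P \<in> carrier ?G" "Q \<in> carrier ?G" "R \<in> carrier ?G" for P Q R
  proof -
    obtain p q r where pqr: "p \<in> loops X x" "q \<in> loops X x" "r \<in> loops X x"
      and "P = loop_class X p" "Q = loop_class X q" "R = loop_class X r"
      using PQR by (auto simp: car)
    moreover have "homotopic_paths X (p +++ (q +++ r)) ((p +++ q) +++ r)"
      using pqr by (intro homotopic_paths_assoc) (auto simp: loops_def)
    then have "loop_class X (p +++ (q +++ r)) = loop_class X ((p +++ q) +++ r)"
      using loop_class_eq_iff[OF loops_join[OF pqr(1) loops_join[OF pqr(2,3)]]] by simp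
    ultimately show ?thesis by (simp add: mult loops_join)
  qed
  show "\<one>\<^bsub>?G\<^esub> \<otimes>\<^bsub>?G\<^esub> P = P" if P: "P \<in> carrier ?G" for P
  proof -
    obtain p where p: "p \<in> loops X x" "P = loop_class X p" using P by (auto simp: car)
    have "loop_class X ((\<lambda>_. x) +++ p) = loop_class X p"
      using homotopic_const_join[OF p(1)]
        loop_class_eq_iff[OF loops_join[OF loops_const[OF assms] p(1)]] by simp
    then show ?thesis using p by (simp add: one mult loops_const assms)
  qed
  show "\<exists>Q\<in>carrier ?G. Q \<otimes>\<^bsub>?G\<^esub> P = \<one>\<^bsub>?G\<^esub>" if P: "P \<in> carrier ?G" for P
  proof -
    obtain p where p: "p \<in> loops X x" "P = loop_class X p" using P by (auto simp: car)
    have "loop_class X (reversepath p) \<otimes>\<^bsub>?G\<^esub> P = \<one>\<^bsub>?G\<^esub>"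
      using homotopic_reverse_join[OF p(1)]
        loop_class_eq_iff[OF loops_join[OF loops_reversepath[OF p(1)] p(1)]]
      by (simp add: one mult loops_reversepath p)
    then show ?thesis using p by (auto simp: car loops_reversepath)
  qed
qed

section \<open>Big groups\<close>

text \<open>A letter \<open>(x, True)\<close> stands for \<open>x\<close> and \<open>(x, False)\<close> for its inverse.\<close>

definition eval_word :: "('g, 'm) monoid_scheme \<Rightarrow> ('g \<times> bool) list \<Rightarrow> 'g" where
  "eval_word G w =
     foldr (\<lambda>(x, b) g. (if b then x else inv\<^bsub>G\<^esub> x) \<otimes>\<^bsub>G\<^esub> g) w \<one>\<^bsub>G\<^esub>"

definition reduced_word :: "('g \<times> bool) list \<Rightarrow> bool" where
  "reduced_word w \<longleftrightarrow> successively (\<lambda>(x, b) (y, c). \<not> (x = y \<and> b \<noteq> c)) w"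

definition free_on :: "('g, 'm) monoid_scheme \<Rightarrow> 'g set \<Rightarrow> bool" where
  "free_on G X \<longleftrightarrow> X \<subseteq> carrier G \<and> generate G X = carrier G \<and>
     (\<forall>w. w \<noteq> [] \<and> set w \<subseteq> X \<times> UNIV \<and> reduced_word w \<longrightarrow> eval_word G w \<noteq> \<one>\<^bsub>G\<^esub>)"

text \<open>The basis \<open>X\<close> may be infinite.\<close>

definition big :: "('g, 'm) monoid_scheme \<Rightarrow> bool" where
  "big G \<longleftrightarrow> (\<exists>H X. subgroup H G \<and> free_on (G\<lparr>carrier := H\<rparr>) X \<and> (\<exists>x\<in>X. \<exists>y\<in>X. x \<noteq> y))"

end

theory Submission
  imports Defs
begin

text \<open>The two conics span a pencil whose smooth members are tangent to each other at the same two points. In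
  suitable complex coordinates (\<open>bitangent_conics_normal_form\<close>) the conics are \<open>A = 0\<close> and \<open>A = m\<^sup>2\<close>, where
  \<open>A = x y + z\<^sup>2\<close> and \<open>m\<close> is a multiple of \<open>z\<close>. The pencil is the map \<open>m\<^sup>2 / A\<close> from the complement of the
  conics to the plane without the point \<open>1\<close>. Its fibre over \<open>0\<close> is the chord of contact, counted twice, so the
  map respects the orbifold structure with a cone point of order two at \<open>0\<close>. The orbifold fundamental
  group is \<open>\<int> * \<int>/2\<close>, which contains free groups of rank two. Adding lines to the arrangement does no
  harm, as loops can be pushed off a curve.

  The cone point is resolved by a double cover. Scaling representatives to \<open>A = 1\<close> shows that the quadric
  \<open>A = 1\<close> doubly covers the complement of the first conic, and on this cover \<open>m\<close> itself is a function with
  values in the plane without \<open>1\<close> and \<open>-1\<close>, off the second conic. The fundamental group of the twice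
  punctured plane is free of rank two, and three things remain.

  First, loops that are null homotopic in the projective plane minus the arrangement have null homotopic lifts
  (\<open>null_homotopic_lift\<close>).

  Secondly, two loops in the twice punctured plane have to be shown to be free. The monodromy of a
  covering that is given by three charts makes one of them act on the integer lattice by the shear \<open>(1 2; 0 1)\<close>
  and the other by \<open>(1 0; 2 1)\<close>, and these shears are free by ping-pong (\<open>word_action_shear_neq_id\<close>). The monodromy is homotopy
  invariant since horizontal sections exist over a square (\<open>horizontal_exists_square\<close>).

  Thirdly, the loops have to be realized off the lines. The function \<open>m\<close> has a section over the whole plane, a
  curve that meets each line in at most two points (\<open>finite_line_parameters\<close>), and the loops in the
  plane are flexible enough to avoid the finitely many parameters of such points
  (\<open>free_loops_in_punctured_plane\<close>).\<close>

section \<open>Groups containing free subgroups\<close>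

text \<open>A family whose nonempty reduced words are all nontrivial is injective, as the word \<open>x y\<inverse>\<close> shows,
  so it is a basis of the subgroup that it generates.\<close>

lemma big_if_free_family:
  fixes G :: "('g, 'm) monoid_scheme" and h :: "'i \<Rightarrow> 'g" and i j :: 'i
  assumes "group G" and h: "\<And>i. h i \<in> carrier G" and "i \<noteq> j"
    and free: "\<And>w. w \<noteq> [] \<Longrightarrow> reduced_word w \<Longrightarrow> eval_word G (map (apfst h) w) \<noteq> \<one>\<^bsub>G\<^esub>"
  shows "big G"
proof -
  interpret group G by fact
  have inj: "x = y" if "h x = h y" for x y
  proof (rule ccontr)
    assume "x \<noteq> y"
    then have "eval_word G (map (apfst h) [(x, True), (y, False)]) \<noteq> \<one>\<^bsub>G\<^esub>"
      by (intro free) (auto simp: reduced_word_def)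
    then show False using h that by (simp add: eval_word_def)
  qed
  let ?X = "range h" and ?H = "generate G (range h)"
  have X: "?X \<subseteq> carrier G" using h by auto
  have H: "subgroup ?H G" by (rule generate_is_subgroup[OF X])
  have XH: "?X \<subseteq> ?H" by (auto intro: generate.incl)
  have "free_on (G\<lparr>carrier := ?H\<rparr>) ?X"
    unfolding free_on_def
  proof (intro conjI allI impI)
    show "?X \<subseteq> carrier (G\<lparr>carrier := ?H\<rparr>)" using XH by simp
    show "generate (G\<lparr>carrier := ?H\<rparr>) ?X = carrier (G\<lparr>carrier := ?H\<rparr>)"
      using generate_consistent[OF XH H] by simp
    fix w assume w: "w \<noteq> [] \<and> set w \<subseteq> ?X \<times> UNIV \<and> reduced_word w"
    then have "\<forall>l\<in>set w. \<exists>m. l = apfst h m" by force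
    then obtain w' where w': "w = map (apfst h) w'"
      by (metis ex_map_conv)
    have "reduced_word w'"
      using w inj unfolding w' reduced_word_def
      by (auto simp: successively_map case_prod_beta intro: successively_mono)
    moreover have "w' \<noteq> []" using w w' by auto
    moreover have "eval_word (G\<lparr>carrier := ?H\<rparr>) w = eval_word G w"
    proof -
      have "inv\<^bsub>G\<lparr>carrier := ?H\<rparr>\<^esub> (fst l) = inv\<^bsub>G\<^esub> (fst l)" if "l \<in> set w" for l
      proof (rule m_inv_consistent[OF H])
        have "l \<in> ?X \<times> UNIV" using that w by blast
        then have "fst l \<in> ?X" by (simp add: mem_Times_iff)
        then show "fst l \<in> ?H" using XH by blast
      qed
      then show ?thesis
        unfolding eval_word_def by (intro foldr_cong) (auto simp: case_prod_beta)
    qed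
    ultimately show "eval_word (G\<lparr>carrier := ?H\<rparr>) w \<noteq> \<one>\<^bsub>G\<lparr>carrier := ?H\<rparr>\<^esub>"
      using free w' by simp
  qed
  moreover have "\<exists>x\<in>?X. \<exists>y\<in>?X. x \<noteq> y" using inj[of i j] \<open>i \<noteq> j\<close> by blast
  ultimately show ?thesis
    unfolding big_def using H by (intro exI[of _ ?H] exI[of _ ?X] conjI)
qed

lemma inv_fundamental_group:
  assumes "x \<in> X" "p \<in> loops X x"
  shows "inv\<^bsub>fundamental_group X x\<^esub> loop_class X p = loop_class X (reversepath p)"
proof (rule group.inv_equality[OF group_fundamental_group[OF assms(1)]])
  show "loop_class X (reversepath p) \<otimes>\<^bsub>fundamental_group X x\<^esub> loop_class X p
      = \<one>\<^bsub>fundamental_group X x\<^esub>"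
    using homotopic_reverse_join[OF assms(2)]
      loop_class_eq_iff[OF loops_join[OF loops_reversepath[OF assms(2)] assms(2)]]
    by (simp add: fundamental_group_mult assms loops_reversepath) (simp add: fundamental_group_def)
qed (use assms loops_reversepath in \<open>auto simp: fundamental_group_def\<close>)

definition word_action :: "('i \<Rightarrow> bool \<Rightarrow> 'f \<Rightarrow> 'f) \<Rightarrow> ('i \<times> bool) list \<Rightarrow> 'f \<Rightarrow> 'f" where
  "word_action T w = foldr (\<lambda>(i, b) f. T i b \<circ> f) w id"

text \<open>A word in the loops acts by the same word in the maps \<open>T\<close>, and null homotopic loops act trivially, so the
  loops inherit freeness from the maps. The relation \<open>R \<gamma> f\<close> reads ``the loop \<open>\<gamma>\<close> acts by \<open>f\<close>''. A relation is
  used because below only those loops act that lift to closed loops of a double cover; they represent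
  a subgroup of the fundamental group.\<close>

lemma big_fundamental_groupI:
  fixes T :: "'i \<Rightarrow> bool \<Rightarrow> 'f \<Rightarrow> 'f" and i j :: 'i
  assumes x: "x \<in> X" and p: "\<And>i. p i \<in> loops X x" and "i \<noteq> j"
    and const: "R (\<lambda>_. x) id"
    and join: "\<And>\<gamma> \<delta> f g. \<lbrakk>R \<gamma> f; R \<delta> g\<rbrakk> \<Longrightarrow> R (\<gamma> +++ \<delta>) (f \<circ> g)"
    and pos: "\<And>i. R (p i) (T i True)" and neg: "\<And>i. R (reversepath (p i)) (T i False)"
    and triv: "\<And>\<gamma> f. \<lbrakk>R \<gamma> f; homotopic_paths X \<gamma> (\<lambda>_. x)\<rbrakk> \<Longrightarrow> f = id"
    and free: "\<And>w. w \<noteq> [] \<Longrightarrow> reduced_word w \<Longrightarrow> word_action T w \<noteq> id"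
  shows "big (fundamental_group X x)"
proof (rule big_if_free_family[where h = "\<lambda>i. loop_class X (p i)", OF group_fundamental_group[OF x] _ \<open>i \<noteq> j\<close>])
  let ?G = "fundamental_group X x" and ?h = "\<lambda>i. loop_class X (p i)"
  show "?h i \<in> carrier ?G" for i using p by (simp add: fundamental_group_def)
  have *: "\<exists>\<gamma>. \<gamma> \<in> loops X x \<and> R \<gamma> (word_action T w) \<and>
      eval_word ?G (map (apfst ?h) w) = loop_class X \<gamma>" for w
  proof (induction w)
    case Nil
    have "eval_word ?G (map (apfst ?h) []) = loop_class X (\<lambda>_. x)"
      by (simp add: eval_word_def fundamental_group_def)
    moreover have "R (\<lambda>_. x) (word_action T [])"
      using const unfolding word_action_def foldr.simps id_apply .
    ultimately show ?case using loops_const[OF x] by blast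
  next
    case (Cons l w)
    obtain i b where l: "l = (i, b)" by force
    obtain \<gamma> where \<gamma>: "\<gamma> \<in> loops X x" "R \<gamma> (word_action T w)"
      "eval_word ?G (map (apfst ?h) w) = loop_class X \<gamma>" using Cons by blast
    let ?q = "if b then p i else reversepath (p i)"
    have q: "?q \<in> loops X x" "R ?q (T i b)"
      "(if b then ?h i else inv\<^bsub>?G\<^esub> ?h i) = loop_class X ?q"
      using p pos neg by (auto simp: loops_reversepath inv_fundamental_group[OF x])
    have eval: "eval_word ?G (map (apfst ?h) (l # w)) = loop_class X (?q +++ \<gamma>)"
      using \<gamma>(3) q(3) fundamental_group_mult[OF q(1) \<gamma>(1)] by (simp add: eval_word_def l)
    have "word_action T (l # w) = T i b \<circ> word_action T w"
      by (simp add: word_action_def l)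
    then have "R (?q +++ \<gamma>) (word_action T (l # w))"
      using join[OF q(2) \<gamma>(2)] by (simp only:)
    then show ?case using loops_join[OF q(1) \<gamma>(1)] eval by blast
  qed
  fix w :: "('i \<times> bool) list" assume w: "w \<noteq> []" "reduced_word w"
  obtain \<gamma> where \<gamma>: "\<gamma> \<in> loops X x" "R \<gamma> (word_action T w)"
    "eval_word ?G (map (apfst ?h) w) = loop_class X \<gamma>" using * by blast
  show "eval_word ?G (map (apfst ?h) w) \<noteq> \<one>\<^bsub>?G\<^esub>"
  proof
    assume "eval_word ?G (map (apfst ?h) w) = \<one>\<^bsub>?G\<^esub>"
    then have "loop_class X \<gamma> = loop_class X (\<lambda>_. x)" using \<gamma>(3) by (simp add: fundamental_group_def)
    then have "homotopic_paths X \<gamma> (\<lambda>_. x)" using loop_class_eq_iff[OF \<gamma>(1)] by blast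
    then show False using triv[OF \<gamma>(2)] free[OF w] by blast
  qed
qed

section \<open>A free action on the integer lattice\<close>

text \<open>The two shears are the matrices \<open>(1 2; 0 1)\<close> and \<open>(1 0; 2 1)\<close>, which generate a free group; the
  second argument selects the shear or its inverse.\<close>

fun shear :: "bool \<Rightarrow> bool \<Rightarrow> int \<times> int \<Rightarrow> int \<times> int" where
  "shear True b (x, y) = (x + (if b then 2 else - 2) * y, y)"
| "shear False b (x, y) = (x, y + (if b then 2 else - 2) * x)"

lemma shear_inverse: "shear i b (shear i (\<not> b) v) = v"
  by (cases v; cases i; cases b) auto

fun sector :: "bool \<times> bool \<Rightarrow> (int \<times> int) set" where
  "sector (i, b) = {(x, y). (if i then \<bar>y\<bar> < \<bar>x\<bar> else \<bar>x\<bar> < \<bar>y\<bar>) \<and> (if b then 0 < x * y else x * y < 0)}"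

text \<open>Ping-pong: every letter maps the sectors of all letters but its inverse into its own sector.\<close>

lemma shear_sector:
  assumes "v \<in> sector (j, c)" "\<not> (i = j \<and> b \<noteq> c)"
  shows "shear i b v \<in> sector (i, b)"
proof -
  obtain x y where v: "v = (x, y)" by force
  show ?thesis using assms unfolding v
    by (cases i; cases b; cases j; cases c) (auto simp: zero_less_mult_iff mult_less_0_iff)
qed

lemma sector_disjoint: "v \<in> sector l \<Longrightarrow> v \<in> sector m \<Longrightarrow> l = m"
  by (cases v; cases l; cases m) (auto split: if_splits)

lemma sector_nonempty: "\<exists>v. v \<in> sector l"
proof -
  obtain i b where l: "l = (i, b)" by force
  have "((if i then 2 else 1), (if b then 1 else -1) * (if i then 1 else 2)) \<in> sector l"
    unfolding l by simp
  then show ?thesis by blast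
qed

text \<open>There are four sectors, so some sector is neither that of the first letter nor that of the inverse of
  the last. The word moves every point of such a sector into the sector of its first letter.\<close>

lemma word_action_shear_neq_id:
  assumes "w \<noteq> []" "reduced_word w"
  shows "word_action shear w \<noteq> id"
proof -
  have sector: "word_action shear (l # w) v \<in> sector l"
    if "reduced_word (l # w)" "v \<in> sector m" "m \<noteq> apsnd Not (last (l # w))" for l w m v
    using that(1,3)
  proof (induction w arbitrary: l)
    case Nil
    then show ?case using shear_sector[of v "fst m" "snd m" "fst l" "snd l"] that(2)
      by (cases m; cases l) (auto simp: word_action_def)
  next
    case (Cons k w)
    obtain i b j c where lk: "l = (i, b)" "k = (j, c)" by force
    have red: "reduced_word (k # w)" "\<not> (i = j \<and> b \<noteq> c)"
      using Cons.prems by (auto simp: reduced_word_def lk)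
    have "word_action shear (k # w) v \<in> sector k"
      using Cons.IH red Cons.prems by simp
    then have "shear i b (word_action shear (k # w) v) \<in> sector l"
      using shear_sector red lk by blast
    then show ?case by (simp add: word_action_def lk)
  qed
  obtain l u where w: "w = l # u" using assms by (cases w) auto
  obtain i b where l: "l = (i, b)" by force
  obtain j c where j: "last w = (j, c)" by force
  obtain m where m: "m \<noteq> l" "m \<noteq> apsnd Not (last w)"
    by (metis (full_types) prod.inject l)
  obtain v where v: "v \<in> sector m" using sector_nonempty by blast
  have "word_action shear w v \<in> sector l"
    using sector[of l u v m] assms m v w by simp
  then show ?thesis using v m sector_disjoint by fastforce
qed

section \<open>Parallel transport in coverings given by charts\<close>

text \<open>A transport law \<open>T u v\<close> that is given for nearby points only, and is consistent on small triangles,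
  integrates to a section over the square because the square is star-shaped. To reach \<open>u\<close>, move from
  the corner along the segment to \<open>u\<close> in \<open>n\<close> equal steps. For nearby endpoints \<open>u\<close> and \<open>v\<close> the two subdivided
  segments bound a ladder of \<open>n\<close> small quadrilaterals, and consistency passes from rung to rung.\<close>

lemma transport_on_square:
  fixes T :: "real \<times> real \<Rightarrow> real \<times> real \<Rightarrow> 'f \<Rightarrow> 'f"
  assumes "\<delta> > 0"
    and refl: "\<And>u f. u \<in> {0..1} \<times> {0..1} \<Longrightarrow> T u u f = f"
    and trans: "\<And>u v w f. \<lbrakk>u \<in> {0..1} \<times> {0..1}; v \<in> {0..1} \<times> {0..1}; w \<in> {0..1} \<times> {0..1};
        dist u v < \<delta>; dist v w < \<delta>; dist u w < \<delta>\<rbrakk> \<Longrightarrow> T v w (T u v f) = T u w f"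
  obtains s \<epsilon> where "s (0, 0) = f0" "\<epsilon> > 0"
    "\<And>u v. \<lbrakk>u \<in> {0..1} \<times> {0..1}; v \<in> {0..1} \<times> {0..1}; dist u v < \<epsilon>\<rbrakk> \<Longrightarrow> s v = T u v (s u)"
proof -
  let ?K = "{0..1::real} \<times> {0..1::real}"
  \<comment> \<open>every point of the square has norm at most 2, so each step is shorter than half of \<open>\<delta>\<close>\<close>
  obtain n :: nat where "4 / \<delta> < real n" using reals_Archimedean2 by blast
  moreover have "0 < 4 / \<delta>" using \<open>\<delta> > 0\<close> by simp
  ultimately have "n > 0" by (intro gr0I) auto
  with \<open>4 / \<delta> < real n\<close> \<open>\<delta> > 0\<close> have n: "n > 0" "2 / real n < \<delta> / 2"
    by (auto simp: field_simps)
  define pt where "pt i u = (real i / real n) *\<^sub>R u" for i and u :: "real \<times> real"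
  have pt_in: "pt i u \<in> ?K" if "u \<in> ?K" "i \<le> n" for i u
  proof -
    have "0 \<le> real i / real n" "real i / real n \<le> 1" using that n by auto
    moreover define c where "c = real i / real n"
    ultimately show ?thesis using that(1) unfolding pt_def c_def[symmetric]
      by (cases u) (auto intro: mult_le_one)
  qed
  define s where "s i u = rec_nat f0 (\<lambda>i f. T (pt i u) (pt (Suc i) u) f) i" for i u
  have s0: "s 0 u = f0" and sS: "s (Suc i) u = T (pt i u) (pt (Suc i) u) (s i u)" for i u
    by (simp_all add: s_def)
  have step: "dist (pt i u) (pt (Suc i) u) \<le> 2 / real n" if "u \<in> ?K" for i u
  proof -
    have "pt (Suc i) u - pt i u = (1 / real n) *\<^sub>R u"
      by (simp add: pt_def scaleR_left_diff_distrib[symmetric] diff_divide_distrib[symmetric])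
    then have "dist (pt i u) (pt (Suc i) u) = norm ((1 / real n) *\<^sub>R u)"
      by (metis dist_norm norm_minus_commute)
    then have "dist (pt i u) (pt (Suc i) u) = norm u / real n" by simp
    moreover have "norm u \<le> 2"
      using that norm_Pair_le[of "fst u" "snd u"] by auto
    ultimately show ?thesis using n by (simp add: divide_right_mono)
  qed
  have shrink: "dist (pt i u) (pt i v) \<le> dist u v" if "i \<le> n" for i u v
  proof -
    have "dist (pt i u) (pt i v) = (real i / real n) * dist u v"
      by (simp add: pt_def dist_norm scaleR_diff_right[symmetric])
    also have "\<dots> \<le> 1 * dist u v" using that n by (intro mult_right_mono) auto
    finally show ?thesis by simp
  qed
  \<comment> \<open>the rungs of the ladder\<close>
  have main: "s i v = T (pt i u) (pt i v) (s i u)"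
    if "u \<in> ?K" "v \<in> ?K" "dist u v < \<delta> / 2" "i \<le> n" for i u v
    using that(4)
  proof (induction i)
    case 0
    then show ?case using refl[of 0] by (simp add: s0 pt_def zero_prod_def)
  next
    case (Suc i)
    let ?a = "pt i u" and ?b = "pt i v" and ?a' = "pt (Suc i) u" and ?b' = "pt (Suc i) v"
    have K: "?a \<in> ?K" "?b \<in> ?K" "?a' \<in> ?K" "?b' \<in> ?K"
      using pt_in that Suc.prems by auto
    have d: "dist ?a ?b < \<delta> / 2" "dist ?a' ?b' < \<delta> / 2" "dist ?a ?a' < \<delta> / 2" "dist ?b ?b' < \<delta> / 2"
      using shrink[of i u v] shrink[of "Suc i" u v] step[OF that(1), of i] step[OF that(2), of i]
        that(3) n Suc.prems by auto
    have d': "dist ?a ?b' < \<delta>"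
      using dist_triangle[of ?a ?b' ?b] d by auto
    have "s (Suc i) v = T ?b ?b' (T ?a ?b (s i u))" using Suc by (simp add: sS)
    also have "\<dots> = T ?a ?b' (s i u)" using K d d' \<open>\<delta> > 0\<close> by (intro trans) auto
    also have "\<dots> = T ?a' ?b' (T ?a ?a' (s i u))"
      using K d d' \<open>\<delta> > 0\<close> by (intro trans[symmetric]) auto
    finally show ?case by (simp add: sS)
  qed
  have ptn: "pt n u = u" for u using n by (simp add: pt_def)
  have "s i (0, 0) = f0" for i
  proof (induction i)
    case (Suc i)
    have "pt k (0, 0) = (0, 0)" for k by (simp add: pt_def)
    then show ?case using Suc refl[of "(0, 0)"] by (simp add: sS)
  qed (simp add: s0)
  then have "s n (0, 0) = f0" .
  moreover have "s n v = T u v (s n u)" if "u \<in> ?K" "v \<in> ?K" "dist u v < \<delta> / 2" for u v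
    using main[OF that, of n] by (simp add: ptn)
  ultimately show thesis using that[of "s n" "\<delta> / 2"] \<open>\<delta> > 0\<close> by (metis half_gt_zero)
qed

text \<open>A covering of \<open>Y\<close> with fibre \<open>'f\<close>, given by an atlas: over \<open>D k\<close> the map \<open>\<phi> k y\<close> sends a point of the
  fibre at \<open>y\<close> to its coordinate in the chart \<open>k\<close>, and sheets are the sets of constant coordinate. The
  total space is never topologized; its horizontal sections along maps into \<open>Y\<close> carry all the
  information that is needed.\<close>

locale flat_bundle =
  fixes Y :: "'y::metric_space set" and D :: "'k \<Rightarrow> 'y set" and \<phi> :: "'k \<Rightarrow> 'y \<Rightarrow> 'f \<Rightarrow> 'f"
  assumes open_chart: "open (D k)"
    and cover: "Y = (\<Union>k. D k)"
    and bij_chart: "y \<in> D k \<Longrightarrow> bij (\<phi> k y)"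
    and compatible: "\<lbrakk>connected Z; Z \<subseteq> D j \<inter> D k; x \<in> Z; y \<in> Z; \<phi> j x f = \<phi> j y g\<rbrakk> \<Longrightarrow> \<phi> k x f = \<phi> k y g"
begin

definition horizontal :: "'a::metric_space set \<Rightarrow> ('a \<Rightarrow> 'y) \<Rightarrow> ('a \<Rightarrow> 'f) \<Rightarrow> bool" where
  "horizontal K h s \<longleftrightarrow> (\<forall>u\<in>K. \<forall>k. h u \<in> D k \<longrightarrow>
     (\<exists>e>0. \<forall>v\<in>K. dist u v < e \<longrightarrow> h v \<in> D k \<and> \<phi> k (h v) (s v) = \<phi> k (h u) (s u)))"

lemma horizontal_compose:
  assumes "horizontal K h s" "continuous_on K' g" "g ` K' \<subseteq> K"
  shows "horizontal K' (h \<circ> g) (s \<circ> g)"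
  unfolding horizontal_def
proof (intro ballI allI impI)
  fix u k assume u: "u \<in> K'" "(h \<circ> g) u \<in> D k"
  then obtain e where e: "e > 0" "\<And>v. \<lbrakk>v \<in> K; dist (g u) v < e\<rbrakk> \<Longrightarrow>
      h v \<in> D k \<and> \<phi> k (h v) (s v) = \<phi> k (h (g u)) (s (g u))"
    using assms(1,3) unfolding horizontal_def by (metis comp_apply image_subset_iff)
  obtain d where d: "d > 0" "\<And>v. \<lbrakk>v \<in> K'; dist u v < d\<rbrakk> \<Longrightarrow> dist (g u) (g v) < e"
    using assms(2) u(1) e(1) unfolding continuous_on_iff by (metis dist_commute)
  show "\<exists>e>0. \<forall>v\<in>K'. dist u v < e \<longrightarrow> (h \<circ> g) v \<in> D k \<and>
      \<phi> k ((h \<circ> g) v) ((s \<circ> g) v) = \<phi> k ((h \<circ> g) u) ((s \<circ> g) u)"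
    using d e assms(3) by (intro exI[of _ d]) (auto simp: image_subset_iff)
qed

lemma horizontal_unique:
  assumes "connected K" "horizontal K h s" "horizontal K h s'" "h ` K \<subseteq> Y"
    and "a \<in> K" "s a = s' a" "b \<in> K"
  shows "s b = s' b"
proof -
  have *: "\<exists>e>0. \<forall>v\<in>K. dist u v < e \<longrightarrow> (s v = s' v \<longleftrightarrow> s u = s' u)" if u: "u \<in> K" for u
  proof -
    obtain k where k: "h u \<in> D k" using assms(4) u cover by blast
    obtain e where e: "e > 0" "\<And>v. \<lbrakk>v \<in> K; dist u v < e\<rbrakk> \<Longrightarrow>
        h v \<in> D k \<and> \<phi> k (h v) (s v) = \<phi> k (h u) (s u)"
      using assms(2) u k unfolding horizontal_def by blast
    obtain e' where e': "e' > 0" "\<And>v. \<lbrakk>v \<in> K; dist u v < e'\<rbrakk> \<Longrightarrow>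
        h v \<in> D k \<and> \<phi> k (h v) (s' v) = \<phi> k (h u) (s' u)"
      using assms(3) u k unfolding horizontal_def by blast
    have "s v = s' v \<longleftrightarrow> s u = s' u" if "v \<in> K" "dist u v < min e e'" for v
    proof -
      have "inj (\<phi> k (h v))" "inj (\<phi> k (h u))"
        using e(2)[of v] that k bij_chart bij_is_inj by auto
      then show ?thesis
        using e(2)[of v] e'(2)[of v] that by (metis injD min_less_iff_conj)
    qed
    then show ?thesis using e(1) e'(1) by (intro exI[of _ "min e e'"]) auto
  qed
  have "(\<lambda>u. s u = s' u) b = (\<lambda>u. s u = s' u) a"
  proof (rule connected_local_const[OF assms(1,7,5)], rule ballI)
    fix u assume "u \<in> K"
    then show "\<forall>\<^sub>F v in at u within K. (s u = s' u) = (s v = s' v)"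
      using * unfolding eventually_at by (metis dist_commute)
  qed
  then show ?thesis using assms(6) by simp
qed

lemma horizontal_const:
  assumes "\<And>u. u \<in> K \<Longrightarrow> h u = y"
  shows "horizontal K h (\<lambda>_. f)"
  unfolding horizontal_def using assms by (auto intro!: exI[of _ 1])

lemma horizontal_cong:
  assumes "horizontal K h s" "\<And>u. u \<in> K \<Longrightarrow> h u = h' u"
  shows "horizontal K h' s"
  using assms unfolding horizontal_def by simp

text \<open>On convex domains one chart near each point is enough: on a small ball the image is connected, and
  so the sheets of any other chart are the same there.\<close>

lemma horizontalI:
  fixes K :: "'a::real_normed_vector set"
  assumes "convex K" "continuous_on K h"
    and local: "\<And>u. u \<in> K \<Longrightarrow>
      \<exists>k e. e > 0 \<and> (\<forall>v\<in>K. dist u v < e \<longrightarrow> h v \<in> D k \<and> \<phi> k (h v) (s v) = \<phi> k (h u) (s u))"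
  shows "horizontal K h s"
  unfolding horizontal_def
proof (intro ballI allI impI)
  fix u j assume u: "u \<in> K" "h u \<in> D j"
  obtain k e where e: "e > 0" "\<And>v. \<lbrakk>v \<in> K; dist u v < e\<rbrakk> \<Longrightarrow>
      h v \<in> D k \<and> \<phi> k (h v) (s v) = \<phi> k (h u) (s u)"
    using local[OF u(1)] by blast
  obtain r where r: "r > 0" "ball (h u) r \<subseteq> D j"
    using open_chart u(2) openE by blast
  obtain d where d: "d > 0" "\<And>v. \<lbrakk>v \<in> K; dist u v < d\<rbrakk> \<Longrightarrow> dist (h u) (h v) < r"
    using assms(2) u(1) r(1) unfolding continuous_on_iff by (metis dist_commute)
  define Z where "Z = K \<inter> ball u (min d e)"
  have "connected (h ` Z)"
    unfolding Z_def using assms(1,2)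
    by (intro connected_continuous_image convex_connected convex_Int) (auto intro: continuous_on_subset)
  moreover have "h ` Z \<subseteq> D k \<inter> D j"
    using e(2) d(2) r(2) by (auto simp: Z_def)
  moreover have "u \<in> Z" using u(1) d(1) e(1) by (simp add: Z_def)
  ultimately have "h v \<in> D j \<and> \<phi> j (h v) (s v) = \<phi> j (h u) (s u)" if "v \<in> Z" for v
    using compatible[of "h ` Z" k j "h v" "h u" "s v" "s u"] e(2)[of v] that
    by (auto simp: Z_def)
  then show "\<exists>e>0. \<forall>v\<in>K. dist u v < e \<longrightarrow> h v \<in> D j \<and> \<phi> j (h v) (s v) = \<phi> j (h u) (s u)"
    using d(1) e(1) by (intro exI[of _ "min d e"]) (auto simp: Z_def)
qed

text \<open>By compactness, balls of a fixed radius are mapped into single charts, and the charts define the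
  transport between the points of such a ball. Consistency on small triangles is the
  compatibility of the charts on the connected image of an intersection of two balls.\<close>

lemma horizontal_exists_square:
  fixes h :: "real \<times> real \<Rightarrow> 'y"
  assumes h: "continuous_on ({0..1} \<times> {0..1}) h" "h ` ({0..1} \<times> {0..1}) \<subseteq> Y"
  obtains s where "horizontal ({0..1} \<times> {0..1}) h s" "s (0, 0) = f"
proof -
  let ?K = "{0..1::real} \<times> {0..1::real}"
  have K: "convex ?K" "compact ?K" by (auto intro: convex_Times compact_Times)
  define G where "G = {A. open A \<and> (\<exists>k. h ` (A \<inter> ?K) \<subseteq> D k)}"
  have "?K \<subseteq> \<Union> G"
  proof
    fix u assume u: "u \<in> ?K"
    then obtain k where k: "h u \<in> D k" using h(2) cover by blast
    obtain A where A: "open A" "A \<inter> ?K = h -` D k \<inter> ?K"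
      using h(1) open_chart unfolding continuous_on_open_invariant by metis
    then have "A \<in> G" "u \<in> A" using u k unfolding G_def by blast+
    then show "u \<in> \<Union> G" by blast
  qed
  moreover have "open A" if "A \<in> G" for A using that by (simp add: G_def)
  ultimately have "\<exists>\<delta>>0. \<forall>u\<in>?K. \<exists>A\<in>G. ball u \<delta> \<subseteq> A"
    by (metis Heine_Borel_lemma[OF K(2)])
  then obtain \<delta> where \<delta>: "\<delta> > 0" "\<And>u. u \<in> ?K \<Longrightarrow> \<exists>A\<in>G. ball u \<delta> \<subseteq> A" by metis
  have "\<exists>k. h ` (ball u \<delta> \<inter> ?K) \<subseteq> D k" if u: "u \<in> ?K" for u
  proof -
    obtain A k where "ball u \<delta> \<subseteq> A" "h ` (A \<inter> ?K) \<subseteq> D k"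
      using \<delta>(2)[OF u] unfolding G_def by blast
    then show ?thesis by (intro exI[of _ k]) blast
  qed
  then obtain k where k: "\<And>u. u \<in> ?K \<Longrightarrow> h ` (ball u \<delta> \<inter> ?K) \<subseteq> D (k u)" by metis
  have kD: "h v \<in> D (k u)" if "u \<in> ?K" "v \<in> ?K" "dist u v < \<delta>" for u v
    using k[OF that(1)] that by auto
  define T where "T u v g = inv_into UNIV (\<phi> (k u) (h v)) (\<phi> (k u) (h u) g)" for u v g
  have T: "\<phi> (k u) (h v) (T u v g) = \<phi> (k u) (h u) g" if "u \<in> ?K" "v \<in> ?K" "dist u v < \<delta>" for u v g
    unfolding T_def using bij_chart[OF kD[OF that]] by (simp add: bij_is_surj surj_f_inv_f)
  have inj: "g = g'" if "\<phi> (k u) (h v) g = \<phi> (k u) (h v) g'" "u \<in> ?K" "v \<in> ?K" "dist u v < \<delta>" for u v g g'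
    using bij_chart[OF kD[OF that(2-4)]] that(1) by (meson bij_is_inj injD)
  have refl: "T u u g = g" if "u \<in> ?K" for u g
    using inj[OF T[of u u g]] that \<delta>(1) by simp
  have trans: "T v w (T u v g) = T u w g"
    if uvw: "u \<in> ?K" "v \<in> ?K" "w \<in> ?K" "dist u v < \<delta>" "dist v w < \<delta>" "dist u w < \<delta>" for u v w g
  proof -
    let ?Z = "?K \<inter> ball u \<delta> \<inter> ball v \<delta>"
    have "connected (h ` ?Z)"
      using K(1) h(1)
      by (intro connected_continuous_image convex_connected convex_Int) (auto intro: continuous_on_subset)
    moreover have "h ` ?Z \<subseteq> D (k v) \<inter> D (k u)"
      using kD uvw by auto
    moreover have "h w \<in> h ` ?Z" "h v \<in> h ` ?Z" using uvw \<delta>(1) by auto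
    moreover have "\<phi> (k v) (h w) (T v w (T u v g)) = \<phi> (k v) (h v) (T u v g)"
      using T uvw by blast
    ultimately have "\<phi> (k u) (h w) (T v w (T u v g)) = \<phi> (k u) (h v) (T u v g)"
      by (rule compatible)
    also have "\<dots> = \<phi> (k u) (h w) (T u w g)" using T[of u v g] T[of u w g] uvw by simp
    finally show ?thesis using inj uvw by blast
  qed
  obtain s \<epsilon> where s: "s (0, 0) = f" "\<epsilon> > 0"
    "\<And>u v. \<lbrakk>u \<in> ?K; v \<in> ?K; dist u v < \<epsilon>\<rbrakk> \<Longrightarrow> s v = T u v (s u)"
    using transport_on_square[of \<delta> T f, OF \<delta>(1) refl trans] by blast
  have "horizontal ?K h s"
  proof (rule horizontalI[OF K(1) h(1)])
    fix u assume u: "u \<in> ?K"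
    show "\<exists>k e. e > 0 \<and> (\<forall>v\<in>?K. dist u v < e \<longrightarrow> h v \<in> D k \<and> \<phi> k (h v) (s v) = \<phi> k (h u) (s u))"
    proof (intro exI[of _ "k u"] exI[of _ "min \<epsilon> \<delta>"] conjI ballI impI)
      show "0 < min \<epsilon> \<delta>" using s(2) \<delta>(1) by simp
      fix v assume v: "v \<in> ?K" "dist u v < min \<epsilon> \<delta>"
      show "h v \<in> D (k u)" using kD u v by simp
      show "\<phi> (k u) (h v) (s v) = \<phi> (k u) (h u) (s u)"
        using s(3)[of u v] T[of u v] u v by simp
    qed
  qed
  then show thesis using that s(1) by blast
qed

text \<open>Parallel transport along a path is stated as a relation between the initial and the final point;
  it turns out to be a function of the initial point.\<close>

definition transport :: "(real \<Rightarrow> 'y) \<Rightarrow> 'f \<Rightarrow> 'f \<Rightarrow> bool" where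
  "transport \<gamma> f g \<longleftrightarrow> (\<exists>s. horizontal {0..1} \<gamma> s \<and> s 0 = f \<and> s 1 = g)"

lemma transport_exists:
  assumes "path \<gamma>" "path_image \<gamma> \<subseteq> Y"
  obtains g where "transport \<gamma> f g"
proof -
  have "continuous_on ({0..1} \<times> {0..1}) (\<lambda>u::real \<times> real. \<gamma> (fst u))"
    using assms(1) unfolding path_def
    by (rule continuous_on_compose2[OF _ continuous_on_fst[OF continuous_on_id]]) auto
  moreover have "(\<lambda>u::real \<times> real. \<gamma> (fst u)) ` ({0..1} \<times> {0..1}) \<subseteq> Y"
    using assms(2) by (auto simp: path_image_def)
  ultimately obtain s where s: "horizontal ({0..1} \<times> {0..1}) (\<lambda>u::real \<times> real. \<gamma> (fst u)) s" "s (0, 0) = f"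
    by (rule horizontal_exists_square)
  have "horizontal {0..1} ((\<lambda>u::real \<times> real. \<gamma> (fst u)) \<circ> (\<lambda>t. (t, 0))) (s \<circ> (\<lambda>t. (t, 0)))"
    by (rule horizontal_compose[OF s(1)]) (auto intro!: continuous_intros)
  then have "transport \<gamma> f (s (1, 0))"
    using s(2) unfolding transport_def by (intro exI[of _ "s \<circ> (\<lambda>t. (t, 0))"]) (simp add: o_def)
  then show thesis by (rule that)
qed

lemma transport_unique:
  assumes "path_image \<gamma> \<subseteq> Y" "transport \<gamma> f g" "transport \<gamma> f g'"
  shows "g = g'"
  using assms horizontal_unique[of "{0..1::real}" \<gamma> _ _ 0 1] unfolding transport_def path_image_def
  by auto

lemma transport_reversepath:
  assumes "transport \<gamma> f g"
  shows "transport (reversepath \<gamma>) g f"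
proof -
  obtain s where s: "horizontal {0..1} \<gamma> s" "s 0 = f" "s 1 = g"
    using assms unfolding transport_def by blast
  have "horizontal {0..1} (\<gamma> \<circ> (\<lambda>t. 1 - t)) (s \<circ> (\<lambda>t. 1 - t))"
    by (rule horizontal_compose[OF s(1)]) (auto intro!: continuous_intros)
  then show ?thesis
    using s unfolding transport_def reversepath_def
    by (intro exI[of _ "s \<circ> (\<lambda>t. 1 - t)"]) (simp add: o_def)
qed

text \<open>Take the horizontal section along the joined path and restrict it to the two halves, where it agrees
  with the given sections by uniqueness.\<close>

lemma transport_join:
  assumes "path \<gamma>" "path_image \<gamma> \<subseteq> Y" "path \<delta>" "path_image \<delta> \<subseteq> Y" "pathfinish \<gamma> = pathstart \<delta>"
    and "transport \<gamma> f g" "transport \<delta> g k"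
  shows "transport (\<gamma> +++ \<delta>) f k"
proof -
  have "path (\<gamma> +++ \<delta>)" "path_image (\<gamma> +++ \<delta>) \<subseteq> Y"
    using assms by (auto simp: path_image_join)
  then obtain k' where "transport (\<gamma> +++ \<delta>) f k'" using transport_exists by blast
  then obtain s where s: "horizontal {0..1} (\<gamma> +++ \<delta>) s" "s 0 = f" "s 1 = k'"
    unfolding transport_def by blast
  have "horizontal {0..1} ((\<gamma> +++ \<delta>) \<circ> (\<lambda>t. t / 2)) (s \<circ> (\<lambda>t. t / 2))"
    by (rule horizontal_compose[OF s(1)]) (auto intro!: continuous_intros)
  then have "horizontal {0..1} \<gamma> (s \<circ> (\<lambda>t. t / 2))"
    by (rule horizontal_cong) (auto simp: joinpaths_def)
  then have "transport \<gamma> f (s (1 / 2))"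
    unfolding transport_def using s(2) by (intro exI[of _ "s \<circ> (\<lambda>t. t / 2)"]) simp
  then have mid: "s (1 / 2) = g" using transport_unique assms by blast
  have "horizontal {0..1} ((\<gamma> +++ \<delta>) \<circ> (\<lambda>t. (t + 1) / 2)) (s \<circ> (\<lambda>t. (t + 1) / 2))"
    by (rule horizontal_compose[OF s(1)]) (auto intro!: continuous_intros)
  then have "horizontal {0..1} \<delta> (s \<circ> (\<lambda>t. (t + 1) / 2))"
  proof (rule horizontal_cong)
    fix t :: real assume "t \<in> {0..1}"
    then show "((\<gamma> +++ \<delta>) \<circ> (\<lambda>t. (t + 1) / 2)) t = \<delta> t"
      using assms(5) by (cases "t = 0") (auto simp: joinpaths_def pathfinish_def pathstart_def add_divide_distrib)
  qed
  then have "transport \<delta> g k'"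
    unfolding transport_def using s(3) mid by (intro exI[of _ "s \<circ> (\<lambda>t. (t + 1) / 2)"]) simp
  then have "k' = k" using transport_unique assms by blast
  then show ?thesis using \<open>transport (\<gamma> +++ \<delta>) f k'\<close> by simp
qed

text \<open>Lift the homotopy to a section over the square. It is constant along the two sides on which the
  homotopy is constant, so its restrictions to the other two sides have the same endpoints.\<close>

lemma transport_homotopic:
  assumes "homotopic_paths Y \<gamma> \<delta>" "transport \<gamma> f g"
  shows "transport \<delta> f g"
proof -
  let ?I = "{0..1::real}"
  obtain h where h: "continuous_on (?I \<times> ?I) h" "h \<in> ?I \<times> ?I \<rightarrow> Y"
    and h0: "\<And>t. t \<in> ?I \<Longrightarrow> h (0, t) = \<gamma> t" and h1: "\<And>t. t \<in> ?I \<Longrightarrow> h (1, t) = \<delta> t"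
    and ends: "\<And>t. t \<in> ?I \<Longrightarrow> h (t, 0) = \<gamma> 0 \<and> h (t, 1) = \<gamma> 1"
    using assms(1) unfolding homotopic_paths by (auto simp: pathstart_def pathfinish_def)
  obtain s where s: "horizontal (?I \<times> ?I) h s" "s (0, 0) = f"
    using horizontal_exists_square[OF h(1)] h(2) by blast
  have edge: "horizontal ?I (h \<circ> e) (s \<circ> e)" if "continuous_on ?I e" "e ` ?I \<subseteq> ?I \<times> ?I" for e
    using horizontal_compose[OF s(1)] that by blast
  have vert: "s (t, c) = s (0, c)" if "c \<in> {0, 1}" "t \<in> ?I" for t c
  proof -
    have "horizontal ?I (h \<circ> (\<lambda>t. (t, c))) (s \<circ> (\<lambda>t. (t, c)))"
      using that by (intro edge) (auto intro!: continuous_intros)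
    moreover have "horizontal ?I (h \<circ> (\<lambda>t. (t, c))) (\<lambda>_. s (0, c))"
      using that ends by (intro horizontal_const[of _ _ "\<gamma> c"]) auto
    moreover have "(h \<circ> (\<lambda>t. (t, c))) ` ?I \<subseteq> Y"
    proof (rule image_subsetI)
      fix t :: real assume "t \<in> ?I"
      then have "(t, c) \<in> ?I \<times> ?I" using that(1) by auto
      then show "(h \<circ> (\<lambda>t. (t, c))) t \<in> Y" using h(2) by auto
    qed
    ultimately show ?thesis
      using horizontal_unique[of ?I "h \<circ> (\<lambda>t. (t, c))" "s \<circ> (\<lambda>t. (t, c))" "\<lambda>_. s (0, c)" 0 t] that(2)
      by simp
  qed
  have "horizontal ?I (h \<circ> Pair c) (s \<circ> Pair c)" if "c \<in> ?I" for c
    using that by (intro edge) (auto intro!: continuous_intros)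
  then have "horizontal ?I (h \<circ> Pair 0) (s \<circ> Pair 0)" "horizontal ?I (h \<circ> Pair 1) (s \<circ> Pair 1)"
    by auto
  then have "horizontal ?I \<gamma> (s \<circ> Pair 0)" "horizontal ?I \<delta> (s \<circ> Pair 1)"
    using h0 h1 by (auto elim!: horizontal_cong)
  then have "transport \<gamma> f (s (0, 1))" "transport \<delta> (s (1, 0)) (s (1, 1))"
    unfolding transport_def using s(2) by (metis comp_apply)+
  then have "transport \<gamma> f (s (0, 1))" "transport \<delta> f (s (0, 1))"
    using s(2) vert[of 0 1] vert[of 1 1] by simp_all
  moreover have "path_image \<gamma> \<subseteq> Y" using homotopic_paths_imp_subset assms(1) by blast
  ultimately show ?thesis using transport_unique assms(2) by blast
qed

lemma transport_const: "transport (\<lambda>_. y) f f"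
  unfolding transport_def using horizontal_const[of "{0..1}" "\<lambda>_. y"] by blast

lemma transport_null_homotopic:
  assumes "homotopic_paths Y \<gamma> (\<lambda>_. y)" "transport \<gamma> f g"
  shows "g = f"
proof -
  have "transport (\<lambda>_. y) f g" using transport_homotopic assms by blast
  moreover have "transport (\<lambda>_. y) f f" by (rule transport_const)
  moreover have "path_image (\<lambda>_. y) \<subseteq> Y"
    using homotopic_paths_imp_subset assms(1) by blast
  ultimately show ?thesis using transport_unique by blast
qed

lemma transport_in_chart:
  assumes "path \<gamma>" "path_image \<gamma> \<subseteq> D k" "\<phi> k (pathstart \<gamma>) f = \<phi> k (pathfinish \<gamma>) g"
  shows "transport \<gamma> f g"
proof -
  define s where "s t = inv_into UNIV (\<phi> k (\<gamma> t)) (\<phi> k (\<gamma> 0) f)" for t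
  have bij: "bij (\<phi> k (\<gamma> t))" if "t \<in> {0..1}" for t
    using assms(2) that by (intro bij_chart) (auto simp: path_image_def)
  have s: "\<phi> k (\<gamma> t) (s t) = \<phi> k (\<gamma> 0) f" if "t \<in> {0..1}" for t
    unfolding s_def using bij[OF that] by (simp add: bij_is_surj surj_f_inv_f)
  have "horizontal {0..1} \<gamma> s"
    using assms(1,2) s unfolding path_def
    by (intro horizontalI exI[of _ k] exI[of _ "1::real"]) (auto simp: path_image_def)
  moreover have "s 0 = f" using s[of 0] bij[of 0] by (simp add: bij_is_inj inj_eq)
  moreover have "s 1 = g"
  proof -
    have "\<phi> k (\<gamma> 1) (s 1) = \<phi> k (\<gamma> 1) g"
      using s[of 1] assms(3) by (simp add: pathstart_def pathfinish_def)
    then show ?thesis using bij[of 1] by (simp add: bij_is_inj inj_eq)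
  qed
  ultimately show ?thesis unfolding transport_def by blast
qed

end

section \<open>Monodromy over the twice punctured plane\<close>

text \<open>The points \<open>1\<close> and \<open>-1\<close> cut the real axis into three intervals. Removing from the plane all but one
  of these intervals gives three charts, any two of which overlap exactly in the two open half planes. The
  fibres over the half planes are glued trivially through the middle interval, and by a shear through
  each of the two outer ones.\<close>

fun slit_domain :: "bool option \<Rightarrow> complex set" where
  "slit_domain None = {w. Im w \<noteq> 0 \<or> \<bar>Re w\<bar> < 1}"
| "slit_domain (Some True) = {w. Im w \<noteq> 0 \<or> 1 < Re w}"
| "slit_domain (Some False) = {w. Im w \<noteq> 0 \<or> Re w < -1}"

fun slit_coordinate :: "bool option \<Rightarrow> complex \<Rightarrow> int \<times> int \<Rightarrow> int \<times> int" where
  "slit_coordinate None w = id"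
| "slit_coordinate (Some i) w = (if 0 < Im w then id else shear i True)"

lemma bij_shear: "bij (shear i b)"
  by (rule bijI') (metis shear_inverse, metis shear_inverse)

lemma open_slit_domain: "open (slit_domain k)"
  by (cases k rule: slit_domain.cases)
    (simp_all only: slit_domain.simps,
     (intro open_Collect_disj open_Collect_neq open_Collect_less continuous_intros)+)

lemma slit_domain_overlap:
  assumes "w \<in> slit_domain j" "w \<in> slit_domain k" "j \<noteq> k"
  shows "Im w \<noteq> 0"
  using assms by (cases j rule: slit_domain.cases; cases k rule: slit_domain.cases) auto

lemma slit_domain_cover: "- {1, -1} = (\<Union>k. slit_domain k)"
proof -
  have "w \<in> - {1, -1} \<longleftrightarrow> w \<in> slit_domain None \<or> w \<in> slit_domain (Some True) \<or> w \<in> slit_domain (Some False)"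
    for w by (auto simp: complex_eq_iff)
  then show ?thesis
    by (auto simp: UNIV_option_conv UNIV_bool)
qed

interpretation twice_punctured_plane: flat_bundle "- {1, -1 :: complex}" slit_domain slit_coordinate
proof
  show "open (slit_domain k)" for k by (rule open_slit_domain)
  show "- {1, -1 :: complex} = (\<Union>k. slit_domain k)" by (rule slit_domain_cover)
  show "bij (slit_coordinate k y)" for k y
    using bij_shear by (cases k) auto
  fix Z j k x y f g
  assume Z: "connected Z" "Z \<subseteq> slit_domain j \<inter> slit_domain k" "x \<in> Z" "y \<in> Z"
    and eq: "slit_coordinate j x f = slit_coordinate j y g"
  show "slit_coordinate k x f = slit_coordinate k y g"
  proof (cases "j = k")
    case False
    then have "Im w \<noteq> 0" if "w \<in> Z" for w
      using slit_domain_overlap that Z(2) by blast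
    then have "0 \<notin> Im ` Z" by auto
    moreover have "connected (Im ` Z)"
      using Z(1) by (intro connected_continuous_image continuous_intros)
    ultimately have "0 < Im x \<longleftrightarrow> 0 < Im y"
      using connectedD_interval[of "Im ` Z" "Im x" "Im y" 0]
        connectedD_interval[of "Im ` Z" "Im y" "Im x" 0] Z(3,4) by force
    moreover have "f = g"
      using eq calculation bij_shear[of _ True] by (cases j) (auto split: if_splits dest: bij_is_inj injD)
    ultimately show ?thesis by (cases k) auto
  qed (use eq in simp)
qed

abbreviation "monodromy \<equiv> twice_punctured_plane.transport"

lemma connected_slit_domain: "connected (slit_domain k)"
proof (rule starlike_imp_connected)
  define a :: complex where "a = (case k of None \<Rightarrow> 0 | Some i \<Rightarrow> if i then 2 else - 2)"
  have "closed_segment a w \<subseteq> slit_domain k" if w: "w \<in> slit_domain k" for w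
  proof
    fix z assume "z \<in> closed_segment a w"
    then obtain t where t: "0 \<le> t" "t \<le> 1" "z = (1 - t) *\<^sub>R a + t *\<^sub>R w"
      by (auto simp: closed_segment_def)
    have Im: "Im z = t * Im w" and Re: "Re z = (1 - t) * Re a + t * Re w"
      using t(3) by (auto simp: a_def split: option.splits)
    show "z \<in> slit_domain k"
    proof (cases "t = 0 \<or> Im w = 0")
      case True
      have "\<bar>Re z\<bar> < 1" if "k = None"
      proof -
        have "\<bar>t * Re w\<bar> < 1" if "\<bar>Re w\<bar> < 1 \<or> t = 0"
          using that t mult_left_le_one_le[of "\<bar>Re w\<bar>" t] by (auto simp: abs_mult)
        then show ?thesis using that Re True w by (auto simp: a_def)
      qed
      moreover have "1 < Re z" if "k = Some True"
      proof (cases "t = 0")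
        case False
        have "Im w = 0" "1 < Re w" using that w True False by auto
        then have "0 < t * (Re w - 1)" using t(1) False by simp
        then have "t < t * Re w" by (simp only: right_diff_distrib mult_1_right)
        then show ?thesis using Re t(2) that by (simp only: a_def option.simps if_True) simp
      qed (use Re that in \<open>simp add: a_def\<close>)
      moreover have "Re z < -1" if "k = Some False"
      proof (cases "t = 0")
        case False
        have "Im w = 0" "Re w < -1" using that w True False by auto
        then have "0 < t * (- 1 - Re w)" using t(1) False by simp
        then have "t * Re w < - t" by (simp only: right_diff_distrib mult_minus_right mult_1_right)
        then show ?thesis using Re t(2) that by (simp only: a_def option.simps if_False) simp
      qed (use Re that in \<open>simp add: a_def\<close>)
      ultimately show ?thesis by (cases k rule: slit_domain.cases) auto
    next
      case False
      then show ?thesis using Im by (cases k rule: slit_domain.cases) auto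
    qed
  qed
  moreover have "a \<in> slit_domain k"
    by (cases k rule: slit_domain.cases) (auto simp: a_def)
  ultimately show "starlike (slit_domain k)" unfolding starlike_def by blast
qed

text \<open>Deleting finitely many points does not disconnect an open connected subset of the plane.\<close>

lemma slit_domain_path:
  assumes "finite B" "u \<in> slit_domain k - B" "v \<in> slit_domain k - B"
  obtains p where "path p" "path_image p \<subseteq> slit_domain k - B" "pathstart p = u" "pathfinish p = v"
proof -
  have "path_connected (slit_domain k - B)"
    using open_slit_domain connected_slit_domain countable_finite[OF assms(1)]
    by (intro path_connected_open_diff_countable) auto
  then show thesis using assms that unfolding path_connected_def by blast
qed

text \<open>A loop that goes down through an outer interval and returns through the middle one acts by the shear
  of the outer interval. Only the intervals crossed matter, so finitely many points can be avoided.\<close>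

lemma free_loops_in_punctured_plane:
  assumes B: "finite B" "{1, -1} \<subseteq> B"
  obtains u l where "u \<notin> B"
    "\<And>i::bool. path (l i)" "\<And>i. path_image (l i) \<subseteq> - B" "\<And>i. pathstart (l i) = u" "\<And>i. pathfinish (l i) = u"
    "\<And>i f. monodromy (l i) (shear i True f) f"
proof -
  have "\<exists>r. Complex r y \<notin> B" for y
  proof -
    have "finite ((\<lambda>r. Complex r y) -` B)" using B(1) by (rule finite_vimageI) (auto intro: injI)
    then have "(\<lambda>r. Complex r y) -` B \<noteq> UNIV" using infinite_UNIV_char_0[where 'a=real] by metis
    then show ?thesis by blast
  qed
  then obtain u v where uv: "u \<notin> B" "v \<notin> B" "Im u = 1" "Im v = -1"
    by (metis complex.sel(2))
  then have D: "u \<in> slit_domain k - B" "v \<in> slit_domain k - B" for k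
    by (cases k rule: slit_domain.cases; simp)+
  obtain p where p: "path p" "path_image p \<subseteq> slit_domain None - B" "pathstart p = v" "pathfinish p = u"
    using slit_domain_path B(1) D by metis
  have "\<forall>i. \<exists>q. path q \<and> path_image q \<subseteq> slit_domain (Some i) - B \<and> pathstart q = u \<and> pathfinish q = v"
    using slit_domain_path B(1) D by metis
  then obtain q where q: "\<And>i. path (q i)" "\<And>i. path_image (q i) \<subseteq> slit_domain (Some i) - B"
    "\<And>i. pathstart (q i) = u" "\<And>i. pathfinish (q i) = v" by metis
  \<comment> \<open>\<open>q i\<close> goes down through the outer interval, \<open>p\<close> comes back through the middle one\<close>
  show thesis
  proof (rule that[of u "\<lambda>i. q i +++ p"])
    fix i f
    have "monodromy (q i) (shear i True f) f"
      using q[of i] uv by (intro twice_punctured_plane.transport_in_chart[where k = "Some i"]) auto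
    moreover have "monodromy p f f"
      using p by (intro twice_punctured_plane.transport_in_chart[where k = None]) auto
    moreover have "path_image (q i) \<subseteq> - {1, -1}" "path_image p \<subseteq> - {1, -1}"
      using p(2) q(2)[of i] B(2) by auto
    ultimately show "monodromy (q i +++ p) (shear i True f) f"
      using p q by (intro twice_punctured_plane.transport_join[where g = f]) auto
    show "path_image (q i +++ p) \<subseteq> - B"
      using p q[of i] by (subst path_image_join) auto
  qed (use p q uv in auto)
qed

section \<open>The double cover of the complement of a conic\<close>

lemma continuous_on_abs_cp2: "continuous_on (- {0}) abs_cp2"
proof -
  have "open (abs_cp2 -` U \<inter> - {0})" if "open U" for U
  proof -
    have "abs_cp2 -` U \<inter> - {0} = {z. z \<noteq> 0 \<and> abs_cp2 z \<in> U}" by auto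
    then show ?thesis using that by (simp add: open_cp2_def)
  qed
  moreover have "open (- {0 :: complex^3})" by auto
  ultimately show ?thesis by (simp add: continuous_on_open_vimage)
qed

lemma continuous_on_cp2I:
  fixes f :: "cp2 \<Rightarrow> 'b::topological_space"
  assumes "open U" "continuous_on {z. z \<noteq> 0 \<and> abs_cp2 z \<in> U} (\<lambda>z. f (abs_cp2 z))"
  shows "continuous_on U f"
  unfolding continuous_on_open_vimage[OF assms(1)]
proof (intro allI impI)
  fix B :: "'b set" assume "open B"
  have V: "open {z. z \<noteq> 0 \<and> abs_cp2 z \<in> U}" using assms(1) by (simp add: open_cp2_def)
  have "open ((\<lambda>z. f (abs_cp2 z)) -` B \<inter> {z. z \<noteq> 0 \<and> abs_cp2 z \<in> U})"
    using assms(2) \<open>open B\<close> continuous_on_open_vimage[OF V] by blast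
  also have "(\<lambda>z. f (abs_cp2 z)) -` B \<inter> {z. z \<noteq> 0 \<and> abs_cp2 z \<in> U} = {z. z \<noteq> 0 \<and> abs_cp2 z \<in> f -` B \<inter> U}"
    by auto
  finally show "open (f -` B \<inter> U)" by (simp add: open_cp2_def)
qed

lemma rep_abs_cp2:
  assumes "z \<noteq> 0"
  obtains c where "c \<noteq> 0" "rep_cp2 (abs_cp2 z) = c *s z"
proof -
  have "rep_cp2 (abs_cp2 z) \<noteq> 0" "abs_cp2 (rep_cp2 (abs_cp2 z)) = abs_cp2 z"
    using Quotient3_abs_rep[OF Quotient3_cp2, of "abs_cp2 z"]
      Quotient3_rep_reflp[OF Quotient3_cp2, of "abs_cp2 z"] unfolding proportional_def by auto
  then obtain c where "rep_cp2 (abs_cp2 z) = c *s z"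
    using abs_cp2_eq_iff[OF assms, of "rep_cp2 (abs_cp2 z)"] by metis
  moreover from this have "c \<noteq> 0" using \<open>rep_cp2 (abs_cp2 z) \<noteq> 0\<close> by auto
  ultimately show thesis using that by blast
qed

lemma continuous_quadratic_form [continuous_intros]:
  "continuous_on S f \<Longrightarrow> continuous_on S (\<lambda>x. quadratic_form A (f x))"
  unfolding quadratic_form_def by (intro continuous_intros)

lemma continuous_linear_form [continuous_intros]:
  "continuous_on S f \<Longrightarrow> continuous_on S (\<lambda>x. linear_form a (f x))"
  unfolding linear_form_def by (intro continuous_intros)

text \<open>Sending \<open>z\<close> to the rank one matrix \<open>z z\<^sup>T\<close> identifies exactly \<open>z\<close> and \<open>- z\<close>. It gives the double cover of
  the complement of a conic as a covering between subsets of normed spaces, along which homotopies of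
  paths can be lifted.\<close>

definition square_tensor :: "complex^'n \<Rightarrow> complex^'n^'n" where
  "square_tensor z = (\<chi> i j. z $ i * z $ j)"

lemma square_tensor_scale: "square_tensor (c *s z) = (\<chi> i j. c\<^sup>2 * square_tensor z $ i $ j)"
  by (simp add: square_tensor_def vec_eq_iff power2_eq_square ac_simps)

lemma square_tensor_uminus [simp]: "square_tensor (- z) = square_tensor z"
  by (simp add: square_tensor_def)

lemma continuous_square_tensor [continuous_intros]:
  "continuous_on S f \<Longrightarrow> continuous_on S (\<lambda>x. square_tensor (f x))"
  unfolding square_tensor_def by (intro continuous_intros continuous_on_vec_lambda)

text \<open>Near \<open>a a\<^sup>T\<close> the two sheets are distinguished by the sign of the real part of \<open>c = \<langle>z, a\<rangle>\<close>. Both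
  \<open>c\<^sup>2\<close> and \<open>c z\<close> are linear functions of \<open>z z\<^sup>T\<close>, so \<open>z\<close> is recovered as \<open>\<plusminus> c z / \<surd>c\<^sup>2\<close>; the
  principal branch of the root is continuous where \<open>Re c \<noteq> 0\<close>.\<close>

lemma covering_space_square_tensor:
  fixes C :: "(complex^'n) set"
  assumes "0 \<notin> C" and sym: "\<And>z. z \<in> C \<Longrightarrow> - z \<in> C"
  shows "covering_space C square_tensor (square_tensor ` C)"
proof (rule covering_spaceI)
  show "continuous_on C square_tensor" using continuous_square_tensor[OF continuous_on_id] by simp
  fix M assume "M \<in> square_tensor ` C"
  then obtain a where a: "a \<in> C" "M = square_tensor a" by blast
  define herm where "herm z = (\<Sum>i\<in>UNIV. z $ i * cnj (a $ i))" for z :: "complex^'n"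
  define contr where "contr N = (\<chi> i. \<Sum>j\<in>UNIV. N $ i $ j * cnj (a $ j))" for N :: "complex^'n^'n"
  have contr: "contr (square_tensor z) = herm z *s z" for z
    by (simp add: contr_def square_tensor_def herm_def vec_eq_iff sum_distrib_right sum_distrib_left ac_simps)
  have herm_scale: "herm (c *s z) = c * herm z" for c z
    by (simp add: herm_def sum_distrib_left ac_simps)
  have herm_contr: "herm (contr (square_tensor z)) = (herm z)\<^sup>2" for z
    by (simp add: contr herm_scale power2_eq_square)
  have herm_uminus: "herm (- z) = - herm z" for z by (simp add: herm_def sum_negf)
  have [continuous_intros]: "continuous_on S f \<Longrightarrow> continuous_on S (\<lambda>x. herm (f x))"
    for S :: "'c::topological_space set" and f
    unfolding herm_def by (intro continuous_intros)
  have [continuous_intros]: "continuous_on S f \<Longrightarrow> continuous_on S (\<lambda>x. contr (f x))"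
    for S :: "'c::topological_space set" and f
    unfolding contr_def by (intro continuous_intros continuous_on_vec_lambda)
  have herm_a: "0 < Re (herm a)"
  proof -
    have "herm a = of_real (\<Sum>i\<in>UNIV. (cmod (a $ i))\<^sup>2)"
      unfolding herm_def by (simp add: complex_norm_square del: of_real_power)
    moreover obtain i where "a $ i \<noteq> 0" using a(1) assms(1) by (metis vec_eq_iff zero_index)
    then have "0 < (\<Sum>i\<in>UNIV. (cmod (a $ i))\<^sup>2)"
      by (intro sum_pos2[where i = i]) auto
    ultimately show ?thesis by simp
  qed
  define T where "T = {N \<in> square_tensor ` C. herm (contr N) \<notin> \<real>\<^sub>\<le>\<^sub>0}"
  have nonpos: "c\<^sup>2 \<in> \<real>\<^sub>\<le>\<^sub>0 \<longleftrightarrow> Re c = 0" for c :: complex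
    by (cases c) (auto simp: complex_nonpos_Reals_iff power2_eq_square mult_le_0_iff)
  define V where "V b = {z \<in> C. 0 < (if b then 1 else -1) * Re (herm z)}" for b
  define q where "q b N = (if b then 1 else -1) *s (inverse (csqrt (herm (contr N))) *s contr N)" for b N
  have q: "q b (square_tensor z) = z" if "z \<in> V b" for b z
  proof -
    have "csqrt ((herm z)\<^sup>2) = (if b then 1 else -1) * herm z"
    proof (cases b)
      case True
      then show ?thesis using that csqrt_square[of "herm z"] by (simp add: V_def)
    next
      case False
      then show ?thesis using that csqrt_square[of "- herm z"] by (simp add: V_def)
    qed
    moreover have "herm z \<noteq> 0" using that by (auto simp: V_def)
    ultimately show ?thesis
      by (simp add: q_def herm_contr) (simp add: contr vector_smult_assoc)
  qed
  have onto: "\<exists>z. z \<in> V b \<and> N = square_tensor z" if "N \<in> T" for N b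
  proof -
    obtain z where z: "z \<in> C" "N = square_tensor z" using \<open>N \<in> T\<close> by (auto simp: T_def)
    then have "Re (herm z) \<noteq> 0" using \<open>N \<in> T\<close> by (simp add: T_def herm_contr nonpos)
    then have "z \<in> V b \<or> - z \<in> V b" using z(1) sym by (auto simp: V_def herm_uminus)
    then show ?thesis using z(2) by auto
  qed
  have into: "square_tensor z \<in> T" if "z \<in> V b" for z b
    using that by (auto simp: V_def T_def herm_contr nonpos)
  have homeo: "homeomorphism (V b) T square_tensor (q b)" for b
  proof (rule homeomorphismI)
    show "continuous_on (V b) square_tensor" using continuous_square_tensor[OF continuous_on_id] by simp
    have "continuous_on T (\<lambda>N. csqrt (herm (contr N)))"
      by (rule continuous_on_compose2[OF continuous_on_csqrt], intro continuous_intros)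
        (auto simp: T_def)
    moreover have "csqrt (herm (contr N)) \<noteq> 0" if "N \<in> T" for N using that by (auto simp: T_def)
    ultimately show "continuous_on T (q b)"
      unfolding q_def vector_scalar_mult_def
      by (intro continuous_intros continuous_on_vec_lambda) auto
    show "square_tensor ` V b \<subseteq> T" using into by blast
    show "q b ` T \<subseteq> V b"
    proof (rule image_subsetI)
      fix N assume "N \<in> T"
      then obtain z where "z \<in> V b" "N = square_tensor z" using onto by blast
      then show "q b N \<in> V b" using q[of z b] by simp
    qed
    show "square_tensor (q b N) = N" if N: "N \<in> T" for N
    proof -
      obtain z where "z \<in> V b" "N = square_tensor z" using onto[OF N] by blast
      then show ?thesis using q[of z b] by simp
    qed
  qed (rule q)
  show "\<exists>T. M \<in> T \<and> openin (top_of_set (square_tensor ` C)) T \<and>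
      (\<exists>v. \<Union>v = C \<inter> square_tensor -` T \<and> (\<forall>u\<in>v. openin (top_of_set C) u) \<and> pairwise disjnt v \<and>
        (\<forall>u\<in>v. \<exists>q. homeomorphism u T square_tensor q))"
  proof (intro exI[of _ T] exI[of _ "range V"] conjI)
    show "M \<in> T" using a herm_a by (auto simp: T_def herm_contr nonpos)
    have "open ((\<lambda>N. herm (contr N)) -` (- \<real>\<^sub>\<le>\<^sub>0))"
      by (intro open_vimage open_Compl closed_nonpos_Reals_complex continuous_intros)
    moreover have "(\<lambda>N. herm (contr N)) -` (- \<real>\<^sub>\<le>\<^sub>0) = {N. herm (contr N) \<notin> \<real>\<^sub>\<le>\<^sub>0}" by auto
    ultimately have "open {N. herm (contr N) \<notin> \<real>\<^sub>\<le>\<^sub>0}" by simp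
    then show "openin (top_of_set (square_tensor ` C)) T"
      unfolding openin_open T_def by (intro exI[of _ "{N. herm (contr N) \<notin> \<real>\<^sub>\<le>\<^sub>0}"]) auto
    show "\<Union> (range V) = C \<inter> square_tensor -` T"
      by (auto simp: V_def T_def herm_contr nonpos UNIV_bool)
    have "open {z. 0 < (if b then 1 else -1) * Re (herm z)}" for b
      by (intro open_Collect_less continuous_intros)
    then show "\<forall>u\<in>range V. openin (top_of_set C) u"
      unfolding openin_open V_def by (auto intro!: exI[of _ "{z. 0 < (if _ then 1 else -1) * Re (herm z)}"])
    show "pairwise disjnt (range V)"
      by (auto simp: pairwise_def disjnt_def V_def split: if_splits)
    show "\<forall>u\<in>range V. \<exists>q. homeomorphism u T square_tensor q" using homeo by blast
  qed
qed simp

text \<open>The map \<open>[z] \<mapsto> z z\<^sup>T / A(z)\<close> is well defined and continuous off the conic \<open>A = 0\<close>, and on points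
  with \<open>A(z) = 1\<close> it is the double cover just constructed. It carries the null homotopy to one
  that can be lifted.\<close>

lemma null_homotopic_lift:
  fixes \<gamma> :: "real \<Rightarrow> complex^3"
  assumes C: "\<And>z. z \<in> C \<Longrightarrow> quadratic_form A z = 1" and sym: "\<And>z. z \<in> C \<Longrightarrow> - z \<in> C"
    and \<gamma>: "path \<gamma>" "path_image \<gamma> \<subseteq> C" "pathstart \<gamma> = a"
    and hom: "homotopic_paths (abs_cp2 ` C) (abs_cp2 \<circ> \<gamma>) (\<lambda>_. abs_cp2 a)"
  shows "homotopic_paths C \<gamma> (\<lambda>_. a)"
proof -
  have q0: "quadratic_form A 0 = 0" by (simp add: quadratic_form_def)
  then have C0: "0 \<notin> C" using C by force
  define \<psi> where "\<psi> p = (\<chi> i j. square_tensor (rep_cp2 p) $ i $ j / quadratic_form A (rep_cp2 p))" for p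
  have \<psi>: "\<psi> (abs_cp2 z) = (\<chi> i j. square_tensor z $ i $ j / quadratic_form A z)" if z: "z \<noteq> 0" for z
  proof -
    obtain c where "c \<noteq> 0" "rep_cp2 (abs_cp2 z) = c *s z" using rep_abs_cp2[OF z] .
    then show ?thesis
      by (simp add: \<psi>_def square_tensor_scale quadratic_form_scale)
  qed
  have \<psi>C: "\<psi> (abs_cp2 z) = square_tensor z" if "z \<in> C" for z
  proof -
    have "z \<noteq> 0" using that C0 by auto
    then show ?thesis using C[OF that] \<psi> by (simp add: vec_eq_iff)
  qed
  let ?U = "{abs_cp2 z | z. z \<noteq> 0 \<and> quadratic_form A z \<noteq> 0}"
  have U: "{z. z \<noteq> 0 \<and> abs_cp2 z \<in> ?U} = {z. quadratic_form A z \<noteq> 0}"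
  proof (intro equalityI subsetI)
    fix z assume "z \<in> {z. z \<noteq> 0 \<and> abs_cp2 z \<in> ?U}"
    then obtain w where "z \<noteq> 0" "abs_cp2 z = abs_cp2 w" "w \<noteq> 0" "quadratic_form A w \<noteq> 0" by auto
    moreover from this obtain c where "w = c *s z" using abs_cp2_eq_iff by blast
    ultimately show "z \<in> {z. quadratic_form A z \<noteq> 0}" by (auto simp: quadratic_form_scale)
  qed (use q0 in auto)
  have "open {z. quadratic_form A z \<noteq> 0}"
    by (intro open_Collect_neq continuous_intros)
  then have "open ?U" unfolding open_cp2_def U .
  then have "continuous_on ?U \<psi>"
  proof (rule continuous_on_cp2I, unfold U)
    have "continuous_on {z. quadratic_form A z \<noteq> 0} (\<lambda>z. \<chi> i j. square_tensor z $ i $ j / quadratic_form A z)"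
      by (intro continuous_intros continuous_on_vec_lambda) auto
    moreover have "z \<noteq> 0" if "quadratic_form A z \<noteq> 0" for z using that q0 by auto
    ultimately show "continuous_on {z. quadratic_form A z \<noteq> 0} (\<lambda>z. \<psi> (abs_cp2 z))"
      using \<psi> by (elim continuous_on_eq) simp
  qed
  moreover have "abs_cp2 ` C \<subseteq> ?U" using C C0 by force
  ultimately have "continuous_on (abs_cp2 ` C) \<psi>" by (rule continuous_on_subset)
  moreover have "\<psi> \<in> abs_cp2 ` C \<rightarrow> square_tensor ` C" using \<psi>C by auto
  ultimately have hom': "homotopic_paths (square_tensor ` C) (\<psi> \<circ> (abs_cp2 \<circ> \<gamma>)) (\<psi> \<circ> (\<lambda>_. abs_cp2 a))"
    using homotopic_paths_continuous_image[OF hom] by blast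
  have aC: "a \<in> C" using \<gamma> by (metis pathstart_in_path_image subsetD)
  show ?thesis
  proof (rule covering_space_lift_homotopic_paths[OF covering_space_square_tensor[OF C0 sym] _ _ _ _ hom' \<gamma>(1,2)])
    show "path (\<psi> \<circ> (abs_cp2 \<circ> \<gamma>))" "path (\<psi> \<circ> (\<lambda>_::real. abs_cp2 a))"
      using homotopic_paths_imp_path[OF hom'] by auto
    show "path_image (\<psi> \<circ> (abs_cp2 \<circ> \<gamma>)) \<subseteq> square_tensor ` C"
      "path_image (\<psi> \<circ> (\<lambda>_::real. abs_cp2 a)) \<subseteq> square_tensor ` C"
      using homotopic_paths_imp_subset[OF hom'] by auto
    show "square_tensor (\<gamma> t) = (\<psi> \<circ> (abs_cp2 \<circ> \<gamma>)) t" if "t \<in> {0..1}" for t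
    proof -
      have "\<gamma> t \<in> C" using \<gamma>(2) that by (auto simp: path_image_def)
      then show ?thesis using \<psi>C by simp
    qed
    show "square_tensor a = (\<psi> \<circ> (\<lambda>_::real. abs_cp2 a)) t" for t using \<psi>C[OF aC] by simp
    show "path_image (\<lambda>_::real. a) \<subseteq> C" using aC by (auto simp: path_image_def)
    show "path (\<lambda>_::real. a)" by (simp add: path_def)
    show "pathstart \<gamma> = pathstart (\<lambda>_. a)" using \<gamma>(3) by (simp add: pathstart_def)
  qed
qed

section \<open>Conics tangent at two points\<close>

definition polar_form :: "complex^3^3 \<Rightarrow> complex^3 \<Rightarrow> complex^3 \<Rightarrow> complex" where
  "polar_form A z = linear_form (A *v z)"

lemma linear_form_add: "linear_form a (z + w) = linear_form a z + linear_form a w"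
  by (simp add: linear_form_def algebra_simps sum.distrib)

lemma linear_form_diff: "linear_form a (z - w) = linear_form a z - linear_form a w"
  by (simp add: linear_form_def algebra_simps sum_subtractf)

lemma linear_form_axis: "linear_form a (axis i 1) = a $ i"
  by (simp add: linear_form_def axis_def if_distrib cong: if_cong)

lemma linear_form_eq_0_iff: "(\<forall>z. linear_form a z = 0) \<longleftrightarrow> a = 0"
proof
  assume "\<forall>z. linear_form a z = 0"
  then show "a = 0" using linear_form_axis[of a] by (simp add: vec_eq_iff)
qed (simp add: linear_form_def)

lemma quadratic_form_polar: "quadratic_form A z = polar_form A z z"
  by (simp add: quadratic_form_def polar_form_def linear_form_def matrix_vector_mult_def
      sum_distrib_left sum_distrib_right ac_simps)

lemma polar_form_sym:
  assumes "transpose A = A"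
  shows "polar_form A z w = polar_form A w z"
proof -
  have sym: "A $ i $ j = A $ j $ i" for i j
    using assms by (metis (no_types, lifting) transpose_def vec_lambda_beta)
  have "polar_form A z w = (\<Sum>i\<in>UNIV. \<Sum>j\<in>UNIV. A $ i $ j * z $ j * w $ i)"
    by (simp add: polar_form_def linear_form_def matrix_vector_mult_def sum_distrib_right)
  also have "\<dots> = (\<Sum>j\<in>UNIV. \<Sum>i\<in>UNIV. A $ i $ j * z $ j * w $ i)" by (rule sum.swap)
  also have "\<dots> = polar_form A w z"
    by (simp add: polar_form_def linear_form_def matrix_vector_mult_def sum_distrib_right sum_distrib_left sym ac_simps)
  finally show ?thesis .
qed

lemma polar_form_linear_left:
  "polar_form A (z + w) v = polar_form A z v + polar_form A w v"
  "polar_form A (z - w) v = polar_form A z v - polar_form A w v"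
  "polar_form A (c *s z) v = c * polar_form A z v"
  by (simp_all add: polar_form_def linear_form_def matrix_vector_mult_def algebra_simps sum.distrib
      sum_subtractf sum_distrib_left)

lemma polar_form_linear_right:
  "polar_form A v (z + w) = polar_form A v z + polar_form A v w"
  "polar_form A v (z - w) = polar_form A v z - polar_form A v w"
  "polar_form A v (c *s z) = c * polar_form A v z"
  by (simp_all add: polar_form_def linear_form_add linear_form_diff linear_form_scale)

lemma polar_form_zero: "polar_form A v 0 = 0"
  by (simp add: polar_form_def linear_form_def)

lemmas polar_form_linear = polar_form_linear_left polar_form_linear_right

lemma smooth_polar_form:
  assumes "smooth_conic_equation A C" "z \<noteq> 0" "polar_form A z z = 0"
  obtains w where "polar_form A z w \<noteq> 0"
proof -
  have "transpose A = A" "gradient (quadratic_form A) z \<noteq> 0"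
    using assms unfolding smooth_conic_equation_def conic_equation_def by (auto simp: quadratic_form_polar)
  then have "A *v z \<noteq> 0" by (auto simp: gradient_quadratic_form)
  then show thesis using that linear_form_eq_0_iff[of "A *v z"] by (auto simp: polar_form_def)
qed

lemma mem_conic_iff:
  assumes "conic_equation A C" "z \<noteq> 0"
  shows "abs_cp2 z \<in> C \<longleftrightarrow> polar_form A z z = 0"
  using assms abs_cp2_in_zero_locus_iff[where n = 2 and F = "quadratic_form A", OF quadratic_form_scale]
  by (simp add: conic_equation_def quadratic_form_polar)

lemma mem_line_iff:
  assumes "z \<noteq> 0"
  shows "abs_cp2 z \<in> zero_locus (linear_form a) \<longleftrightarrow> linear_form a z = 0"
  using assms abs_cp2_in_zero_locus_iff[where n = 1 and F = "linear_form a"] by (simp add: linear_form_scale)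

lemma extend_to_spanning_triple:
  fixes P Q :: "complex^3"
  assumes "P \<noteq> 0" "\<And>c. Q \<noteq> c *s P"
  obtains V where "\<And>a b. V \<noteq> a *s P + b *s Q" "\<And>z. \<exists>a b c. z = a *s P + b *s Q + c *s V"
proof -
  have mem2: "z \<in> vec.span {Q, P} \<longleftrightarrow> (\<exists>a b. z = a *s P + b *s Q)" for z
    by (auto simp: vec.span_breakdown_eq algebra_simps) (metis add.commute)+
  have "Q \<noteq> 0" using assms(2)[of 0] by auto
  have indep: "vec.independent {Q, P}"
    using assms by (intro vec.independent_insertI vec.independent_empty) (auto simp: vec.span_breakdown_eq)
  have "vec.span {Q, P} \<noteq> UNIV"
  proof
    assume "vec.span {Q, P} = UNIV"
    then have "vec.dim (UNIV :: (complex^3) set) \<le> card {Q, P}"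
      by (intro vec.dim_le_card) auto
    also have "\<dots> \<le> 2" by (simp add: card_insert_if)
    finally show False unfolding vec_dim_card by simp
  qed
  then obtain V where V: "V \<notin> vec.span {Q, P}" by blast
  then have "vec.independent {V, Q, P}" using indep by (rule vec.independent_insertI)
  moreover have "card {V, Q, P} = 3"
  proof -
    have "V \<noteq> Q" "V \<noteq> P" using V by (auto intro: vec.span_base)
    moreover have "Q \<noteq> P" using assms(2)[of 1] by auto
    ultimately show ?thesis by simp
  qed
  ultimately have "UNIV \<subseteq> vec.span {V, Q, P}"
    by (intro vec.card_ge_dim_independent) (use vec_dim_card[where 'a=complex and 'n=3] in \<open>auto simp del: vec.dim_UNIV\<close>)
  then have "z \<in> vec.span {V, Q, P}" for z by blast
  then have "\<exists>c. z - c *s V \<in> vec.span {Q, P}" for z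
    using vec.span_breakdown_eq[of z V "{Q, P}"] by blast
  then have "\<exists>a b c. z = a *s P + b *s Q + c *s V" for z
    unfolding mem2 by (metis diff_add_cancel)
  with V that show thesis unfolding mem2 by blast
qed

text \<open>\<open>R\<close> is the pole of the chord \<open>P Q\<close>. A smooth conic contains no line, so \<open>P\<close> and \<open>Q\<close> are not conjugate; hence any
  vector outside their span can be corrected by multiples of \<open>P\<close> and \<open>Q\<close> to be conjugate to both.\<close>

lemma conic_chord_frame:
  assumes A: "smooth_conic_equation A C" and PQ: "P \<noteq> 0" "\<And>c. Q \<noteq> c *s P"
    and on: "polar_form A P P = 0" "polar_form A Q Q = 0"
  obtains R where "polar_form A P Q \<noteq> 0" "polar_form A P R = 0" "polar_form A Q R = 0" "polar_form A R R \<noteq> 0"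
    "\<And>z. \<exists>a b c. z = a *s P + b *s Q + c *s R"
proof -
  have sym: "polar_form A z w = polar_form A w z" for z w
    using A by (intro polar_form_sym) (simp add: smooth_conic_equation_def conic_equation_def)
  obtain V where V: "\<And>a b. V \<noteq> a *s P + b *s Q" and span: "\<And>z. \<exists>a b c. z = a *s P + b *s Q + c *s V"
    using extend_to_spanning_triple[OF PQ] by blast
  have nondeg: "z = 0" if "polar_form A z P = 0" "polar_form A z Q = 0" "polar_form A z V = 0" for z
  proof (rule ccontr)
    assume "z \<noteq> 0"
    have z: "polar_form A z w = 0" for w
      using span[of w] that by (auto simp: polar_form_linear)
    then show False using smooth_polar_form[OF A \<open>z \<noteq> 0\<close>] by blast
  qed
  define \<alpha> where "\<alpha> = polar_form A P Q"
  have \<alpha>: "\<alpha> \<noteq> 0"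
  proof
    assume "\<alpha> = 0"
    define a b where "a = polar_form A P V" and "b = polar_form A Q V"
    have "b *s P - a *s Q = 0"
      using on \<open>\<alpha> = 0\<close> by (intro nondeg) (simp_all add: polar_form_linear a_def b_def \<alpha>_def sym[of Q P])
    then have eq: "a *s Q = b *s P" by simp
    have "a = 0"
    proof (rule ccontr)
      assume "a \<noteq> 0"
      then have "Q = inverse a *s (a *s Q)" by (simp add: vector_smult_assoc)
      also have "\<dots> = (inverse a * b) *s P" by (simp add: eq vector_smult_assoc)
      finally show False using PQ(2) by blast
    qed
    then have "P = 0" using on \<open>\<alpha> = 0\<close> by (intro nondeg) (simp_all add: a_def \<alpha>_def)
    then show False using PQ(1) by simp
  qed
  define R where "R = V - (polar_form A V Q / \<alpha>) *s P - (polar_form A V P / \<alpha>) *s Q"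
  have V_R: "V = (polar_form A V Q / \<alpha>) *s P + (polar_form A V P / \<alpha>) *s Q + R"
    by (simp add: R_def)
  have R: "polar_form A P R = 0" "polar_form A Q R = 0"
    using \<alpha> on sym[of Q P] by (simp_all add: R_def polar_form_linear \<alpha>_def sym[of V])
  have span': "\<exists>a b c. z = a *s P + b *s Q + c *s R" for z
  proof -
    obtain a b c where "z = a *s P + b *s Q + c *s V" using span by blast
    also have "\<dots> = (a + c * (polar_form A V Q / \<alpha>)) *s P + (b + c * (polar_form A V P / \<alpha>)) *s Q + c *s R"
      by (subst V_R) (simp add: algebra_simps vector_smult_assoc)
    finally show ?thesis by blast
  qed
  have "polar_form A R R \<noteq> 0"
  proof
    assume RR: "polar_form A R R = 0"
    have R': "polar_form A R P = 0" "polar_form A R Q = 0"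
      using R sym[of R P] sym[of R Q] by simp_all
    then have "polar_form A R (a *s P + b *s Q + R) = 0" for a b
      using RR by (simp add: polar_form_linear_right)
    then have "polar_form A R V = 0" using V_R by metis
    with R' have "R = 0" by (intro nondeg)
    then show False using V V_R by simp
  qed
  then show thesis using that \<alpha> R span' unfolding \<alpha>_def by blast
qed

lemma polar_form_expand:
  assumes "transpose A = A"
  shows "polar_form A (a *s P + b *s Q + c *s R) (a' *s P + b' *s Q + c' *s R)
    = a * a' * polar_form A P P + b * b' * polar_form A Q Q + c * c' * polar_form A R R
      + (a * b' + b * a') * polar_form A P Q + (a * c' + c * a') * polar_form A P R
      + (b * c' + c * b') * polar_form A Q R"
proof -
  have "polar_form A Q P = polar_form A P Q" "polar_form A R P = polar_form A P R"
    "polar_form A R Q = polar_form A Q R"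
    using polar_form_sym[OF assms] by blast+
  then show ?thesis by (simp add: polar_form_linear) (simp add: algebra_simps)
qed

lemma polar_form_eqI:
  assumes "transpose A = A" "transpose B = B"
    and span: "\<And>z. \<exists>a b c. z = a *s P + b *s Q + c *s R"
    and "polar_form B P P = t * polar_form A P P" "polar_form B Q Q = t * polar_form A Q Q"
      "polar_form B R R = t * polar_form A R R" "polar_form B P Q = t * polar_form A P Q"
      "polar_form B P R = t * polar_form A P R" "polar_form B Q R = t * polar_form A Q R"
  shows "polar_form B z w = t * polar_form A z w"
proof -
  obtain a b c where z: "z = a *s P + b *s Q + c *s R" using span by blast
  obtain a' b' c' where w: "w = a' *s P + b' *s Q + c' *s R" using span by blast
  show ?thesis
    unfolding z w polar_form_expand[OF assms(1)] polar_form_expand[OF assms(2)] assms(4-)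
    by (simp add: algebra_simps)
qed

text \<open>In the frame of a chord the conic is the curve \<open>s \<mapsto> P + k s\<^sup>2 Q + s R\<close>, together with \<open>Q\<close>. A second form that
  vanishes at \<open>P\<close>, at \<open>Q\<close> and along this curve restricts to a polynomial in \<open>s\<close> that is identically zero, which
  leaves only one free coefficient.\<close>

lemma conic_equation_unique:
  assumes A: "smooth_conic_equation A C" and B: "conic_equation B C"
    and PQ: "P \<noteq> 0" "\<And>c. Q \<noteq> c *s P" "abs_cp2 P \<in> C" "abs_cp2 Q \<in> C"
  obtains t where "\<And>z w. polar_form B z w = t * polar_form A z w"
proof -
  have A': "conic_equation A C" using A by (simp add: smooth_conic_equation_def)
  have tr: "transpose A = A" "transpose B = B" using A' B by (simp_all add: conic_equation_def)
  have "Q \<noteq> 0" using PQ(2)[of 0] by auto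
  have on: "polar_form A P P = 0" "polar_form A Q Q = 0" "polar_form B P P = 0" "polar_form B Q Q = 0"
    using PQ(1,3,4) \<open>Q \<noteq> 0\<close> mem_conic_iff[OF A'] mem_conic_iff[OF B] by auto
  obtain R where R: "polar_form A P Q \<noteq> 0" "polar_form A P R = 0" "polar_form A Q R = 0" "polar_form A R R \<noteq> 0"
    and span: "\<And>z. \<exists>a b c. z = a *s P + b *s Q + c *s R"
    using conic_chord_frame[OF A PQ(1,2) on(1,2)] by blast
  define k where "k = - polar_form A R R / (2 * polar_form A P Q)"
  have k: "k \<noteq> 0" using R by (simp add: k_def)
  have B0: "s^2 * polar_form B R R + 2 * k * s^2 * polar_form B P Q + 2 * s * polar_form B P R
      + 2 * k * s^3 * polar_form B Q R = 0" for s
  proof -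
    let ?z = "P + (k * s^2) *s Q + s *s R"
    have "polar_form A P ?z \<noteq> 0 \<or> s = 0" using R k on by (simp add: polar_form_linear)
    then have z: "?z \<noteq> 0"
    proof
      assume "polar_form A P ?z \<noteq> 0"
      then show ?thesis using polar_form_zero by metis
    qed (use PQ(1) in auto)
    have "polar_form A ?z ?z = 0"
      using polar_form_expand[OF tr(1), of 1 P "k * s^2" Q s R 1 "k * s^2" s] on R
      by (simp add: k_def power2_eq_square)
    then have "polar_form B ?z ?z = 0" using mem_conic_iff[OF A' z] mem_conic_iff[OF B z] by simp
    moreover have "polar_form B ?z ?z = s^2 * polar_form B R R + 2 * k * s^2 * polar_form B P Q
        + 2 * s * polar_form B P R + 2 * k * s^3 * polar_form B Q R"
      using polar_form_expand[OF tr(2), of 1 P "k * s^2" Q s R 1 "k * s^2" s] on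
      by (simp add: algebra_simps power2_eq_square power3_eq_cube)
    ultimately show ?thesis by simp
  qed
  define t where "t = polar_form B P Q / polar_form A P Q"
  \<comment> \<open>three values of the parameter determine the coefficients\<close>
  have eqs: "polar_form B R R + 2 * k * polar_form B P Q + 2 * polar_form B P R + 2 * k * polar_form B Q R = 0"
    "polar_form B R R + 2 * k * polar_form B P Q - 2 * polar_form B P R - 2 * k * polar_form B Q R = 0"
    "4 * polar_form B R R + 8 * k * polar_form B P Q + 4 * polar_form B P R + 16 * k * polar_form B Q R = 0"
    subgoal using B0[of 1] by simp
    subgoal using B0[of "-1"] by (simp add: power3_eq_cube)
    subgoal using B0[of 2] by (simp add: power3_eq_cube)
    done
  have "k * polar_form B Q R = 0" using eqs by algebra
  then have QR: "polar_form B Q R = 0" using k by simp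
  have PR: "polar_form B P R = 0" using eqs QR by algebra
  have RR: "polar_form B R R = - 2 * k * polar_form B P Q" using eqs PR QR by algebra
  have "polar_form B z w = t * polar_form A z w" for z w
  proof (rule polar_form_eqI[OF tr span])
    show "polar_form B R R = t * polar_form A R R" using RR R(1) by (simp add: t_def k_def)
    show "polar_form B P Q = t * polar_form A P Q" using R(1) by (simp add: t_def)
  qed (simp_all add: R(2,3) on QR PR)
  then show thesis by (rule that)
qed

lemma linear_form_proportional:
  assumes "a \<noteq> 0" "zero_locus (linear_form a) = zero_locus (linear_form b)"
  obtains t where "\<And>w. linear_form b w = t * linear_form a w"
proof -
  obtain v where v: "linear_form a v \<noteq> 0" using assms(1) linear_form_eq_0_iff by blast
  have ker: "linear_form b w = 0" if "linear_form a w = 0" for w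
  proof (cases "w = 0")
    case False
    then show ?thesis using mem_line_iff[OF False] that assms(2) by metis
  qed (simp add: linear_form_def)
  have "linear_form b w = (linear_form b v / linear_form a v) * linear_form a w" for w
  proof -
    have "linear_form b (w - (linear_form a w / linear_form a v) *s v) = 0"
      using v by (intro ker) (simp add: linear_form_diff linear_form_scale)
    then show ?thesis by (simp add: linear_form_diff linear_form_scale)
  qed
  then show thesis by (rule that)
qed

text \<open>At a common point where the tangent lines agree, the polars of the point with respect to the two
  conics are proportional. The equations that witness the tangency are multiples of \<open>A\<close> and \<open>B\<close> by
  uniqueness, which is where the second common point enters.\<close>

lemma polar_form_tangent:
  assumes A: "smooth_conic_equation A C" and B: "smooth_conic_equation B D"
    and tan: "tangent_at C D (abs_cp2 P)" and P: "P \<noteq> 0"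
    and Q: "\<And>c. Q \<noteq> c *s P" "abs_cp2 Q \<in> C" "abs_cp2 Q \<in> D"
  obtains t where "t \<noteq> 0" "\<And>w. polar_form B P w = t * polar_form A P w"
proof -
  obtain A' B' z where A': "smooth_conic_equation A' C" and B': "smooth_conic_equation B' D"
    and z: "z \<noteq> 0" "abs_cp2 P = abs_cp2 z"
    and eq: "tangent_line (quadratic_form A') z = tangent_line (quadratic_form B') z"
    and mem: "abs_cp2 P \<in> C" "abs_cp2 P \<in> D"
    using tan unfolding tangent_at_def by blast
  note defs = smooth_conic_equation_def conic_equation_def
  obtain k where k: "z = k *s P" using abs_cp2_eq_iff[OF P z(1)] z(2) by blast
  have k0: "k \<noteq> 0" using k z(1) by auto
  obtain a where a: "\<And>u v. polar_form A' u v = a * polar_form A u v"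
    using conic_equation_unique[OF A _ P Q(1) mem(1) Q(2)] A' by (auto simp: smooth_conic_equation_def)
  obtain b where b: "\<And>u v. polar_form B' u v = b * polar_form B u v"
    using conic_equation_unique[OF B _ P Q(1) mem(2) Q(3)] B' by (auto simp: smooth_conic_equation_def)
  have form: "linear_form (gradient (quadratic_form E) z) w = 2 * polar_form E z w" if "transpose E = E" for E w
    using that by (simp add: gradient_quadratic_form polar_form_def linear_form_def sum_distrib_left ac_simps)
  have "gradient (quadratic_form A') z \<noteq> 0"
    using A' z mem(1) mem_conic_iff[of A' C z] by (auto simp: smooth_conic_equation_def quadratic_form_polar)
  then obtain t where "\<And>w. linear_form (gradient (quadratic_form B') z) w = t * linear_form (gradient (quadratic_form A') z) w"
    using linear_form_proportional eq unfolding tangent_line_def by metis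
  then have "polar_form B' z w = t * polar_form A' z w" for w
    using form[of A' w] form[of B' w] A' B' by (simp add: defs)
  then have t: "b * polar_form B P w = (t * a) * polar_form A P w" for w
    using k0 by (simp add: a b k polar_form_linear mult.left_commute)
  obtain w where w: "polar_form B' z w \<noteq> 0"
    using smooth_polar_form[OF B' z(1)] mem_conic_iff[of B' D z] B' mem(2) z by (metis smooth_conic_equation_def)
  then have "b \<noteq> 0" by (auto simp: b)
  then have t': "polar_form B P w = (t * a / b) * polar_form A P w" for w
    using t[of w] by (simp add: field_simps)
  moreover have "t * a / b \<noteq> 0"
  proof
    assume "t * a / b = 0"
    then have "polar_form B P w = 0" using t'[of w] by (simp only: mult_zero_left)
    then show False using w by (simp add: b k polar_form_linear)
  qed
  ultimately show thesis using that by blast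
qed

text \<open>Let \<open>P\<close> and \<open>Q\<close> be the points of tangency and \<open>R\<close> the pole of their chord. Proportionality of the polars
  at \<open>P\<close> and \<open>Q\<close>, with a common factor since the values at \<open>(P, Q)\<close> agree, says that both forms split
  along the span of \<open>P, Q\<close> and that of \<open>R\<close>, and are proportional on the first summand. So \<open>A = x y + z\<^sup>2\<close> after scaling, and \<open>B\<close> differs from a multiple of \<open>A\<close> by
  a multiple of the square \<open>z\<^sup>2\<close> of the equation of the chord. The latter is nonzero as the conics are distinct.\<close>

theorem bitangent_conics_normal_form:
  assumes A: "smooth_conic_equation A C" and B: "smooth_conic_equation B D" and "C \<noteq> D"
    and "p \<noteq> q" and tan: "tangent_at C D p" "tangent_at C D q"
  obtains P Q R :: "complex^3" and X Y Z :: "complex^3 \<Rightarrow> complex" and \<beta> \<mu> :: complex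
  where "\<And>v. v = X v *s P + Y v *s Q + Z v *s R"
    and "\<And>x y z. X (x *s P + y *s Q + z *s R) = x"
    and "\<And>x y z. Y (x *s P + y *s Q + z *s R) = y"
    and "\<And>x y z. Z (x *s P + y *s Q + z *s R) = z"
    and "continuous_on UNIV X" "continuous_on UNIV Y" "continuous_on UNIV Z"
    and "\<And>v. quadratic_form A v = X v * Y v + (Z v)\<^sup>2"
    and "\<beta> \<noteq> 0" "\<mu> \<noteq> 0" "\<And>v. quadratic_form B v = \<beta> * (quadratic_form A v - (\<mu> * Z v)\<^sup>2)"
proof -
  obtain P0 where P0: "P0 \<noteq> 0" "p = abs_cp2 P0" using cp2_cases .
  obtain Q where Q: "Q \<noteq> 0" "q = abs_cp2 Q" using cp2_cases .
  have PQ: "Q \<noteq> c *s P0" for c using abs_cp2_eq_iff[OF P0(1) Q(1)] P0(2) Q(2) \<open>p \<noteq> q\<close> by blast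
  have QP: "P0 \<noteq> c *s Q" for c using abs_cp2_eq_iff[OF Q(1) P0(1)] P0(2) Q(2) \<open>p \<noteq> q\<close> by metis
  have cA: "conic_equation A C" and cB: "conic_equation B D"
    using A B by (simp_all add: smooth_conic_equation_def)
  then have tr: "transpose A = A" "transpose B = B" by (simp_all add: conic_equation_def)
  have mem: "abs_cp2 P0 \<in> C" "abs_cp2 P0 \<in> D" "abs_cp2 Q \<in> C" "abs_cp2 Q \<in> D"
    using tan P0(2) Q(2) by (auto simp: tangent_at_def)
  have on: "polar_form A P0 P0 = 0" "polar_form A Q Q = 0"
    using mem mem_conic_iff[OF cA] P0(1) Q(1) by auto
  obtain R0 where R0: "polar_form A P0 Q \<noteq> 0" "polar_form A P0 R0 = 0" "polar_form A Q R0 = 0" "polar_form A R0 R0 \<noteq> 0"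
    and span: "\<And>z. \<exists>a b c. z = a *s P0 + b *s Q + c *s R0"
    using conic_chord_frame[OF A P0(1) PQ on] by blast
  obtain \<beta> where \<beta>: "\<beta> \<noteq> 0" "\<And>w. polar_form B P0 w = \<beta> * polar_form A P0 w"
    using polar_form_tangent[OF A B _ P0(1) PQ mem(3,4)] tan P0(2) by blast
  obtain \<beta>' where \<beta>': "\<beta>' \<noteq> 0" "\<And>w. polar_form B Q w = \<beta>' * polar_form A Q w"
    using polar_form_tangent[OF A B _ Q(1) QP mem(1,2)] tan Q(2) by blast
  have "\<beta>' * polar_form A P0 Q = \<beta> * polar_form A P0 Q"
    using \<beta>(2)[of Q] \<beta>'(2)[of P0] polar_form_sym[OF tr(1), of P0 Q] polar_form_sym[OF tr(2), of P0 Q] by simp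
  then have eq: "\<beta>' = \<beta>" using R0 by simp
  define \<alpha> where "\<alpha> = polar_form A P0 Q"
  define r where "r = csqrt (polar_form A R0 R0)"
  have \<alpha>: "\<alpha> \<noteq> 0" and r: "r \<noteq> 0" "r\<^sup>2 = polar_form A R0 R0" using R0 by (simp_all add: \<alpha>_def r_def)
  define \<kappa> where "\<kappa> = 1 - polar_form B R0 R0 / (\<beta> * r\<^sup>2)"
  have \<kappa>: "\<kappa> \<noteq> 0"
  proof
    assume "\<kappa> = 0"
    then have RR: "polar_form B R0 R0 = \<beta> * polar_form A R0 R0"
      using \<beta>(1) r by (simp add: \<kappa>_def field_simps)
    have "polar_form B z w = \<beta> * polar_form A z w" for z w
      by (rule polar_form_eqI[OF tr span]) (simp_all only: \<beta>(2) \<beta>'(2) RR eq)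
    then have "abs_cp2 z \<in> C \<longleftrightarrow> abs_cp2 z \<in> D" if "z \<noteq> 0" for z
      using mem_conic_iff[OF cA that] mem_conic_iff[OF cB that] \<beta>(1) by simp
    then have "C = D" by (metis cp2_cases subsetI subset_antisym)
    then show False using \<open>C \<noteq> D\<close> by simp
  qed
  define \<mu> where "\<mu> = csqrt \<kappa>"
  have \<mu>: "\<mu> \<noteq> 0" "\<mu>\<^sup>2 = \<kappa>" using \<kappa> by (simp_all add: \<mu>_def)
  define P where "P = inverse (2 * \<alpha>) *s P0"
  define R where "R = inverse r *s R0"
  define X where "X v = 2 * polar_form A Q v" for v
  define Y where "Y v = polar_form A P0 v / \<alpha>" for v
  define Z where "Z v = polar_form A R0 v / r" for v
  have sym: "polar_form A Q P0 = \<alpha>" "polar_form A R0 P0 = 0" "polar_form A R0 Q = 0"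
    using polar_form_sym[OF tr(1)] R0 by (simp_all add: \<alpha>_def)
  have XYZ: "X (x *s P + y *s Q + z *s R) = x" "Y (x *s P + y *s Q + z *s R) = y"
    "Z (x *s P + y *s Q + z *s R) = z" for x y z
    using \<alpha> r on R0 sym
    by (simp_all add: X_def Y_def Z_def P_def R_def polar_form_linear_right \<alpha>_def[symmetric] r(2)[symmetric] power2_eq_square)
  have frame: "v = X v *s P + Y v *s Q + Z v *s R" for v
  proof -
    obtain a b c where "v = a *s P0 + b *s Q + c *s R0" using span by blast
    then have "v = (2 * \<alpha> * a) *s P + b *s Q + (r * c) *s R"
    proof -
      have "2 * \<alpha> * a * inverse (2 * \<alpha>) = a" "r * c * inverse r = c" using \<alpha> r by (simp_all add: field_simps)
      then show ?thesis using \<open>v = _\<close> by (simp only: P_def R_def vector_smult_assoc)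
    qed
    then show ?thesis using XYZ by metis
  qed
  have PR: "polar_form A P P = 0" "polar_form A P Q = 1 / 2" "polar_form A P R = 0" "polar_form A Q R = 0" "polar_form A R R = 1"
    "polar_form B P P = 0" "polar_form B P Q = \<beta> / 2" "polar_form B P R = 0" "polar_form B Q R = 0" "polar_form B R R = \<beta> * (1 - \<kappa>)"
    using \<alpha> r on R0 \<beta> \<beta>'
    by (simp_all add: P_def R_def polar_form_linear \<alpha>_def[symmetric] r(2)[symmetric] power2_eq_square \<kappa>_def)
      (simp_all add: field_simps)
  have QQ: "polar_form B Q Q = 0" using \<beta>'(2) on by simp
  have qA: "quadratic_form A v = X v * Y v + (Z v)\<^sup>2" for v
    using polar_form_expand[OF tr(1), of "X v" P "Y v" Q "Z v" R "X v" "Y v" "Z v"] PR on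
    unfolding frame[of v, symmetric] quadratic_form_polar by (simp add: power2_eq_square)
  have qB: "quadratic_form B v = \<beta> * (quadratic_form A v - (\<mu> * Z v)\<^sup>2)" for v
    using polar_form_expand[OF tr(2), of "X v" P "Y v" Q "Z v" R "X v" "Y v" "Z v"] PR QQ
    unfolding frame[of v, symmetric] qA power_mult_distrib \<mu>(2) quadratic_form_polar[of B]
    by (simp add: power2_eq_square algebra_simps)
  have "continuous_on UNIV (polar_form A v)" for v
    unfolding polar_form_def by (intro continuous_linear_form continuous_on_id)
  then have "continuous_on UNIV X" "continuous_on UNIV Y" "continuous_on UNIV Z"
    unfolding X_def Y_def Z_def using \<alpha> r(1) by (auto intro!: continuous_intros)
  then show thesis using frame XYZ qA qB \<beta>(1) \<mu>(1) by (intro that[of X P Y Q Z R \<beta> \<mu>])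
qed

section \<open>Complements of bitangent conics and lines\<close>

lemma continuous_vec_scale [continuous_intros]:
  fixes f :: "'a::topological_space \<Rightarrow> complex" and g :: "'a \<Rightarrow> complex^'n"
  shows "continuous_on S f \<Longrightarrow> continuous_on S g \<Longrightarrow> continuous_on S (\<lambda>x. f x *s g x)"
  unfolding vector_scalar_mult_def by (intro continuous_intros continuous_on_vec_lambda)

text \<open>The curve in question is the section \<open>w \<mapsto> (s, (1 - z\<^sup>2) / s, z)\<close>, \<open>z = w / \<mu>\<close>, of the affine quadric
  \<open>x y + z\<^sup>2 = 1\<close> over the plane. A linear form restricts to it as a polynomial of degree at most two, whose
  coefficients determine the form.\<close>

lemma finite_line_parameters:
  fixes P Q R a :: "complex^3"
  assumes "a \<noteq> 0" and span: "\<And>v. \<exists>x y z. v = x *s P + y *s Q + z *s R" and "s \<noteq> 0" "\<mu> \<noteq> 0"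
  shows "finite {w. linear_form a (s *s P + ((1 - (w / \<mu>)\<^sup>2) / s) *s Q + (w / \<mu>) *s R) = 0}"
proof -
  let ?p = "[: s * linear_form a P + linear_form a Q / s, linear_form a R / \<mu>, - linear_form a Q / (s * \<mu>\<^sup>2) :]"
  have "?p \<noteq> 0"
  proof
    assume "?p = 0"
    then have "linear_form a P = 0" "linear_form a Q = 0" "linear_form a R = 0" using assms(3,4) by auto
    then have "linear_form a v = 0" for v
      using span[of v] by (auto simp: linear_form_add linear_form_scale)
    then show False using \<open>a \<noteq> 0\<close> linear_form_eq_0_iff by blast
  qed
  moreover have "linear_form a (s *s P + ((1 - (w / \<mu>)\<^sup>2) / s) *s Q + (w / \<mu>) *s R) = poly ?p w" for w
    using assms(3,4) by (simp add: linear_form_add linear_form_scale field_simps power2_eq_square)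
  ultimately show ?thesis using poly_roots_finite[of ?p] by simp
qed

text \<open>Let \<open>W\<close> be the double cover of the complement \<open>U\<close> inside the affine quadric \<open>A = 1\<close>, and \<open>E\<close> the larger
  cover that ignores the lines. The function \<open>m\<close> maps \<open>E\<close> to the twice punctured plane, and it has a
  section \<open>\<sigma>\<close> that stays in \<open>W\<close> except over finitely many points. So the free loops of the
  punctured plane can be chosen to lift to \<open>W\<close>. Conversely, a loop of \<open>W\<close> that dies in \<open>U\<close> dies in the
  complement of the two conics, hence in \<open>E\<close> by lifting the homotopy, and its image under \<open>m\<close> acts
  trivially.\<close>

theorem big_bitangent_conics_lines:
  assumes A: "smooth_conic_equation A C" and B: "smooth_conic_equation B D" and "C \<noteq> D"
    and "p \<noteq> q" and tan: "tangent_at C D p" "tangent_at C D q"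
    and "finite Ls" and lines: "\<And>L. L \<in> Ls \<Longrightarrow> \<exists>a. a \<noteq> 0 \<and> L = zero_locus (linear_form a)"
    and x0: "x0 \<notin> C \<union> D \<union> \<Union>Ls"
  shows "big (fundamental_group (UNIV - (C \<union> D \<union> \<Union>Ls)) x0)"
proof -
  obtain P Q R X Y Z \<beta> \<mu> where frame: "\<And>v. v = X v *s P + Y v *s Q + Z v *s R"
    and X: "\<And>x y z. X (x *s P + y *s Q + z *s R) = x"
    and Y: "\<And>x y z. Y (x *s P + y *s Q + z *s R) = y"
    and Z: "\<And>x y z. Z (x *s P + y *s Q + z *s R) = z"
    and cont: "continuous_on UNIV X" "continuous_on UNIV Y" "continuous_on UNIV Z"
    and qA: "\<And>v. quadratic_form A v = X v * Y v + (Z v)\<^sup>2"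
    and \<beta>: "\<beta> \<noteq> 0" and \<mu>: "\<mu> \<noteq> 0" and qB: "\<And>v. quadratic_form B v = \<beta> * (quadratic_form A v - (\<mu> * Z v)\<^sup>2)"
    by (rule bitangent_conics_normal_form[OF A B \<open>C \<noteq> D\<close> \<open>p \<noteq> q\<close> tan]) (rule that, assumption+)
  obtain a where a: "\<And>L. L \<in> Ls \<Longrightarrow> a L \<noteq> 0" "\<And>L. L \<in> Ls \<Longrightarrow> L = zero_locus (linear_form (a L))"
    using lines by metis
  define U where "U = UNIV - (C \<union> D \<union> \<Union>Ls)"
  define m where "m v = \<mu> * Z v" for v
  define E where "E = {v. quadratic_form A v = 1 \<and> m v \<in> - {1, -1}}"
  define G where "G = {v. m v \<in> - {1, -1}} \<inter> (\<Inter>L\<in>Ls. {v. linear_form (a L) v \<noteq> 0})"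
  define W where "W = {v. quadratic_form A v = 1} \<inter> G"
  have q0: "quadratic_form A 0 = 0" by (simp add: quadratic_form_def)
  have contm: "continuous_on S m" for S
    unfolding m_def using continuous_on_subset[OF cont(3)] by (intro continuous_intros) auto
  have mem_CD: "abs_cp2 v \<in> C \<longleftrightarrow> quadratic_form A v = 0" "abs_cp2 v \<in> D \<longleftrightarrow> quadratic_form B v = 0" if "v \<noteq> 0" for v
    using that mem_conic_iff[of A C v] mem_conic_iff[of B D v] A B
    by (simp_all add: smooth_conic_equation_def quadratic_form_polar)
  have scale_m: "m (- v) = - m v" for v
  proof -
    have "- v = (- X v) *s P + (- Y v) *s Q + (- Z v) *s R"
      by (subst frame[of v]) (simp add: vector_smult_lneg)
    then have "Z (- v) = - Z v" using Z by metis
    then show ?thesis by (simp add: m_def)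
  qed
  have mem_U: "abs_cp2 v \<in> U \<longleftrightarrow> v \<in> W" if "quadratic_form A v = 1" for v
  proof -
    have "v \<noteq> 0" using that q0 by auto
    moreover have "quadratic_form B v = 0 \<longleftrightarrow> m v = 1 \<or> m v = -1"
      using \<beta> that by (auto simp: qB m_def[symmetric] power2_eq_1_iff)
    moreover have "abs_cp2 v \<in> L \<longleftrightarrow> linear_form (a L) v = 0" if "L \<in> Ls" for L
      using a(2)[OF that] mem_line_iff[OF \<open>v \<noteq> 0\<close>] by metis
    ultimately show ?thesis
      using that mem_CD by (auto simp: U_def W_def G_def)
  qed
  have repr: "\<exists>v. quadratic_form A v = 1 \<and> y = abs_cp2 v" if y: "y \<in> U" for y
  proof -
    obtain z where z: "z \<noteq> 0" "y = abs_cp2 z" using cp2_cases .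
    then have q: "quadratic_form A z \<noteq> 0" using y mem_CD by (auto simp: U_def)
    let ?c = "inverse (csqrt (quadratic_form A z))"
    have "quadratic_form A (?c *s z) = 1" using q by (simp add: quadratic_form_scale power_inverse)
    moreover have "?c *s z \<noteq> 0" using q z(1) by simp
    ultimately show ?thesis using abs_cp2_eq_iff[OF z(1)] z(2) by metis
  qed
  have W_E: "W \<subseteq> E" by (auto simp: W_def G_def E_def)
  have U_E: "U \<subseteq> abs_cp2 ` E" using repr mem_U W_E by blast
  have E0: "0 \<notin> E" using q0 by (simp add: E_def)
  obtain v0 where v0: "v0 \<in> W" "x0 = abs_cp2 v0"
    using repr[of x0] mem_U x0 unfolding U_def by auto
  have "open G"
  proof -
    have "open (m -` (- {1, -1}))" using contm by (intro open_vimage) auto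
    moreover have "open {v. linear_form (a L) v \<noteq> 0}" for L
      by (intro open_Collect_neq continuous_intros)
    ultimately show ?thesis unfolding G_def using \<open>finite Ls\<close>
      by (intro open_Int open_INT) (auto simp: vimage_def)
  qed
  \<comment> \<open>The section needs a base point with nonzero first coordinate; if necessary, move a little along
    a curve on the quadric that leaves the hyperplane \<open>X = 0\<close>.\<close>
  obtain \<delta> where \<delta>: "path \<delta>" "path_image \<delta> \<subseteq> W" "pathstart \<delta> = v0" "X (pathfinish \<delta>) \<noteq> 0"
  proof (cases "X v0 = 0")
    case False
    have "path (\<lambda>_::real. v0)" by (simp add: path_def)
    with False v0 that[of "\<lambda>_. v0"] show thesis by (auto simp: path_image_def pathstart_def pathfinish_def)
  next
    case True
    define y z where "y = Y v0" and "z = Z v0"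
    have z2: "z * z = 1" using v0(1) True by (simp add: W_def qA z_def power2_eq_square)
    \<comment> \<open>The third coordinate is linear in \<open>t\<close>, and \<open>t\<close> divides one minus its square;
      the second coordinate is the quotient.\<close>
    define c where "c t = complex_of_real t *s P + (y - of_real t * y\<^sup>2 / 4) *s Q + (z * (1 - of_real t * y / 2)) *s R" for t
    have contc: "continuous_on S c" for S
      unfolding c_def by (intro continuous_intros) auto
    have c0: "c 0 = v0"
      using frame[of v0] True by (simp add: c_def y_def z_def)
    have qc: "quadratic_form A (c t) = 1" for t
    proof -
      have "quadratic_form A (c t) = of_real t * (y - of_real t * y\<^sup>2 / 4) + z * z * (1 - of_real t * y / 2)\<^sup>2"
        unfolding qA c_def X Y Z by (simp add: power2_eq_square)
      then show ?thesis by (simp add: z2 power2_eq_square field_simps)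
    qed
    have "open (c -` G)" using \<open>open G\<close> contc by (intro open_vimage) auto
    moreover have "0 \<in> c -` G" using c0 v0(1) by (simp add: W_def)
    ultimately obtain e where e: "e > 0" "cball 0 e \<subseteq> c -` G" using open_contains_cball by metis
    show thesis
    proof (rule that[of "\<lambda>s. c (s * e)"])
      show "path (\<lambda>s. c (s * e))"
        unfolding path_def by (intro continuous_on_compose2[OF contc[of UNIV]] continuous_intros) auto
      have "c (s * e) \<in> W" if "s \<in> {0..1}" for s
      proof -
        have "s * e \<in> cball 0 e" using that e(1) by (simp add: mult_left_le_one_le)
        then show ?thesis using e(2) qc by (auto simp: W_def)
      qed
      then show "path_image (\<lambda>s. c (s * e)) \<subseteq> W" by (auto simp: path_image_def)
      show "pathstart (\<lambda>s. c (s * e)) = v0" by (simp add: pathstart_def c0)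
      show "X (pathfinish (\<lambda>s. c (s * e))) \<noteq> 0"
        unfolding pathfinish_def c_def X using e(1) by simp
    qed
  qed
  define v1 where "v1 = pathfinish \<delta>"
  define s where "s = X v1"
  have s: "s \<noteq> 0" using \<delta>(4) by (simp add: s_def v1_def)
  have v1: "v1 \<in> W" using \<delta>(2) pathfinish_in_path_image v1_def by blast
  define \<sigma> where "\<sigma> w = s *s P + ((1 - (w / \<mu>)\<^sup>2) / s) *s Q + (w / \<mu>) *s R" for w
  have cont\<sigma>: "continuous_on S \<sigma>" for S
    unfolding \<sigma>_def using s \<mu> by (intro continuous_intros) auto
  have m\<sigma>: "m (\<sigma> w) = w" for w using \<mu> unfolding m_def \<sigma>_def Z by simp
  have q\<sigma>: "quadratic_form A (\<sigma> w) = 1" for w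
    unfolding qA unfolding \<sigma>_def X Y Z using s by simp
  have \<sigma>v1: "\<sigma> (m v1) = v1"
  proof -
    have "s * Y v1 = 1 - (Z v1)\<^sup>2" using v1 by (simp add: W_def qA s_def algebra_simps)
    then have "Y v1 = (1 - (Z v1)\<^sup>2) / s" using s by (simp add: field_simps)
    then show ?thesis using frame[of v1] \<mu> by (simp add: \<sigma>_def m_def s_def)
  qed
  define S where "S = {w. \<sigma> w \<notin> W}"
  have S_eq: "S = {1, -1} \<union> (\<Union>L\<in>Ls. {w. linear_form (a L) (\<sigma> w) = 0})"
    by (auto simp: S_def W_def G_def q\<sigma> m\<sigma>)
  have span: "\<exists>x y z. v = x *s P + y *s Q + z *s R" for v using frame by blast
  have "finite S"
    unfolding S_eq \<sigma>_def using \<open>finite Ls\<close> finite_line_parameters[OF a(1) span s \<mu>]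
    by (intro finite_UnI finite_UN_I) auto
  obtain u l where u: "u \<notin> S"
    and l: "\<And>i::bool. path (l i)" "\<And>i. path_image (l i) \<subseteq> - S" "\<And>i. pathstart (l i) = u" "\<And>i. pathfinish (l i) = u"
    and mon: "\<And>i f. monodromy (l i) (shear i True f) f"
    using free_loops_in_punctured_plane[OF \<open>finite S\<close>] S_eq by blast
  have "path_connected (- S)"
    using \<open>finite S\<close> by (intro path_connected_complement_countable countable_finite) auto
  moreover have "m v1 \<in> - S" using \<sigma>v1 v1 by (simp add: S_def)
  ultimately obtain \<eta> where \<eta>: "path \<eta>" "path_image \<eta> \<subseteq> - S" "pathstart \<eta> = m v1" "pathfinish \<eta> = u"
    using u unfolding path_connected_def by blast
  have lift: "path (\<sigma> \<circ> g)" "path_image (\<sigma> \<circ> g) \<subseteq> W" if "path g" "path_image g \<subseteq> - S" for g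
    using that cont\<sigma> by (auto intro: path_continuous_image simp: path_image_compose S_def)
  define \<epsilon> where "\<epsilon> = \<delta> +++ (\<sigma> \<circ> \<eta>)"
  have \<epsilon>: "path \<epsilon>" "path_image \<epsilon> \<subseteq> W" "pathstart \<epsilon> = v0" "pathfinish \<epsilon> = \<sigma> u"
  proof -
    have "pathfinish \<delta> = pathstart (\<sigma> \<circ> \<eta>)" using \<eta>(3) \<sigma>v1 by (simp add: pathstart_compose v1_def)
    then show "path \<epsilon>" "path_image \<epsilon> \<subseteq> W" "pathstart \<epsilon> = v0" "pathfinish \<epsilon> = \<sigma> u"
      using \<delta>(1-3) lift[OF \<eta>(1,2)] \<eta>(4) by (auto simp: \<epsilon>_def path_image_join pathfinish_compose)
  qed
  have mpath: "path (m \<circ> g)" "path_image (m \<circ> g) \<subseteq> - {1, -1}" if "path g" "path_image g \<subseteq> E" for g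
    using that contm by (auto intro: path_continuous_image simp: path_image_compose E_def)
  note m\<epsilon> = mpath[OF \<epsilon>(1) order_trans[OF \<epsilon>(2) W_E]]
  \<comment> \<open>\<open>h\<close> identifies the fibre over the base point of the free loops with that over \<open>m v0\<close>\<close>
  have "\<exists>g. monodromy (reversepath (m \<circ> \<epsilon>)) f g" for f
  proof -
    have "path (reversepath (m \<circ> \<epsilon>))" "path_image (reversepath (m \<circ> \<epsilon>)) \<subseteq> - {1, -1}"
      using m\<epsilon> by auto
    then show ?thesis by (rule twice_punctured_plane.transport_exists) (rule exI)
  qed
  then obtain h where h: "\<And>f. monodromy (reversepath (m \<circ> \<epsilon>)) f (h f)" by metis
  then have h': "monodromy (m \<circ> \<epsilon>) (h f) f" for f
    using twice_punctured_plane.transport_reversepath by fastforce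
  have inj_h: "f = g" if "h f = h g" for f g
    using twice_punctured_plane.transport_unique[OF m\<epsilon>(2)] h' that by metis
  define lifted where "lifted \<gamma> \<longleftrightarrow> path \<gamma> \<and> path_image \<gamma> \<subseteq> W \<and> pathstart \<gamma> = v0 \<and> pathfinish \<gamma> = v0" for \<gamma>
  \<comment> \<open>transport leads from \<open>g f\<close> back to \<open>f\<close>, so that joining paths composes maps in the same order\<close>
  define acts where "acts \<gamma> g \<longleftrightarrow> (\<exists>\<gamma>'. lifted \<gamma>' \<and> \<gamma> = abs_cp2 \<circ> \<gamma>' \<and> (\<forall>f. monodromy (m \<circ> \<gamma>') (h (g f)) (h f)))" for \<gamma> g
  define loop where "loop i = \<epsilon> +++ (\<sigma> \<circ> l i) +++ reversepath \<epsilon>" for i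
  have lifted_loop: "lifted (loop i)" for i
  proof -
    have "pathstart (\<sigma> \<circ> l i) = \<sigma> u" "pathfinish (\<sigma> \<circ> l i) = \<sigma> u"
      using l by (simp_all add: pathstart_compose pathfinish_compose)
    then show ?thesis
      using \<epsilon> lift[OF l(1,2)[of i]] by (simp add: lifted_def loop_def path_image_join)
  qed
  have mon_loop: "monodromy (m \<circ> loop i) (h (shear i True f)) (h f)" for i f
  proof -
    have "m \<circ> (\<sigma> \<circ> l i) = l i" using m\<sigma> by (simp add: fun_eq_iff)
    then have eq: "m \<circ> loop i = (m \<circ> \<epsilon>) +++ l i +++ reversepath (m \<circ> \<epsilon>)"
      by (simp add: loop_def path_compose_join path_compose_reversepath)
    have ends: "pathfinish (m \<circ> \<epsilon>) = u" using \<epsilon>(4) m\<sigma> by (simp add: pathfinish_compose)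
    have li: "path_image (l i) \<subseteq> - {1, -1}" using l(2)[of i] S_eq by auto
    have "monodromy (l i +++ reversepath (m \<circ> \<epsilon>)) (shear i True f) (h f)"
      using l(1,3,4) li m\<epsilon> ends by (intro twice_punctured_plane.transport_join[OF _ _ _ _ _ mon h]) auto
    then show ?thesis unfolding eq using l(1,3,4) li m\<epsilon> ends
      by (intro twice_punctured_plane.transport_join[OF _ _ _ _ _ h']) (auto simp: path_image_join)
  qed
  have contabs: "continuous_on W abs_cp2"
    using continuous_on_abs_cp2 W_E E0 by (elim continuous_on_subset) auto
  have W_U: "abs_cp2 ` W \<subseteq> U" using mem_U by (auto simp: W_def)
  have loops: "abs_cp2 \<circ> \<gamma> \<in> loops U x0" if "lifted \<gamma>" for \<gamma>
    using that v0(2) W_U contabs unfolding lifted_def loops_def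
    by (auto intro!: path_continuous_image continuous_on_subset[OF contabs]
        simp: path_image_compose pathstart_compose pathfinish_compose)
  show ?thesis
    unfolding U_def[symmetric]
  proof (rule big_fundamental_groupI[where T = shear and p = "\<lambda>i. abs_cp2 \<circ> loop i" and R = acts and i = True and j = False])
    show "x0 \<in> U" using x0 by (simp add: U_def)
    show "abs_cp2 \<circ> loop i \<in> loops U x0" for i using loops lifted_loop by blast
    show "acts (\<lambda>_. x0) id"
    proof -
      have "monodromy (m \<circ> (\<lambda>_. v0)) f f" for f
        unfolding comp_def by (rule twice_punctured_plane.transport_const)
      moreover have "lifted (\<lambda>_. v0)"
        using v0(1) by (auto simp: lifted_def path_def path_image_def pathstart_def pathfinish_def)
      moreover have "(\<lambda>_. x0) = abs_cp2 \<circ> (\<lambda>_::real. v0)" using v0(2) by auto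
      ultimately show ?thesis unfolding acts_def by (intro exI[of _ "\<lambda>_. v0"]) simp
    qed
    show "acts (abs_cp2 \<circ> loop i) (shear i True)" for i
      unfolding acts_def using lifted_loop mon_loop by blast
    show "acts (reversepath (abs_cp2 \<circ> loop i)) (shear i False)" for i
    proof -
      have "monodromy (m \<circ> reversepath (loop i)) (h (shear i False f)) (h f)" for f
        using twice_punctured_plane.transport_reversepath[OF mon_loop[of i "shear i False f"]]
          shear_inverse[of i True f] by (simp add: path_compose_reversepath)
      moreover have "lifted (reversepath (loop i))" using lifted_loop by (simp add: lifted_def)
      ultimately show ?thesis unfolding acts_def
        by (intro exI[of _ "reversepath (loop i)"]) (simp add: path_compose_reversepath)
    qed
    show "acts (\<gamma> +++ \<delta>) (f \<circ> g)" if "acts \<gamma> f" "acts \<delta> g" for \<gamma> \<delta> f g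
    proof -
      obtain \<gamma>' where \<gamma>': "lifted \<gamma>'" "\<gamma> = abs_cp2 \<circ> \<gamma>'" "\<And>x. monodromy (m \<circ> \<gamma>') (h (f x)) (h x)"
        using \<open>acts \<gamma> f\<close> unfolding acts_def by blast
      obtain \<delta>' where \<delta>': "lifted \<delta>'" "\<delta> = abs_cp2 \<circ> \<delta>'" "\<And>x. monodromy (m \<circ> \<delta>') (h (g x)) (h x)"
        using \<open>acts \<delta> g\<close> unfolding acts_def by blast
      have "monodromy (m \<circ> (\<gamma>' +++ \<delta>')) (h (f (g x))) (h x)" for x
        unfolding path_compose_join using \<gamma>'(1) \<delta>'(1) W_E unfolding lifted_def
        by (intro twice_punctured_plane.transport_join[OF _ _ _ _ _ \<gamma>'(3) \<delta>'(3)] mpath)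
          (auto simp: pathstart_compose pathfinish_compose)
      moreover have "lifted (\<gamma>' +++ \<delta>')"
        using \<gamma>'(1) \<delta>'(1) by (simp add: lifted_def path_image_join)
      ultimately show ?thesis unfolding acts_def
        using \<gamma>'(2) \<delta>'(2) by (intro exI[of _ "\<gamma>' +++ \<delta>'"]) (simp add: path_compose_join)
    qed
    show "f = id" if acts: "acts \<gamma> f" and null: "homotopic_paths U \<gamma> (\<lambda>_. x0)" for \<gamma> f
    proof -
      obtain \<gamma>' where \<gamma>': "lifted \<gamma>'" "\<gamma> = abs_cp2 \<circ> \<gamma>'" "\<And>x. monodromy (m \<circ> \<gamma>') (h (f x)) (h x)"
        using acts unfolding acts_def by blast
      have "homotopic_paths E \<gamma>' (\<lambda>_. v0)"
      proof (rule null_homotopic_lift)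
        show "quadratic_form A v = 1" if "v \<in> E" for v using that by (simp add: E_def)
        show "- v \<in> E" if "v \<in> E" for v
          using that quadratic_form_scale[of A "-1" v] by (auto simp: E_def scale_m minus_equation_iff[of "m v"])
        show "homotopic_paths (abs_cp2 ` E) (abs_cp2 \<circ> \<gamma>') (\<lambda>_. abs_cp2 v0)"
          using homotopic_paths_subset[OF null U_E] \<gamma>'(2) v0(2) by simp
      qed (use \<gamma>'(1) W_E in \<open>auto simp: lifted_def\<close>)
      then have "homotopic_paths (- {1, -1}) (m \<circ> \<gamma>') (m \<circ> (\<lambda>_. v0))"
        by (rule homotopic_paths_continuous_image[OF _ contm]) (auto simp: E_def)
      then have "h x = h (f x)" for x
        using twice_punctured_plane.transport_null_homotopic \<gamma>'(3) by (simp add: o_def)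
      then show ?thesis using inj_h by (metis eq_id_iff)
    qed
    show "word_action shear w \<noteq> id" if "w \<noteq> []" "reduced_word w" for w
      using that by (rule word_action_shear_neq_id)
  qed simp
qed

theorem corollary1p4:
  fixes S C1 C2 :: "cp2 set" and Ls :: "cp2 set set" and p q x0 :: cp2
  assumes "real_conic_line_arrangement {C1, C2} Ls"
    and "S = C1 \<union> C2 \<union> \<Union>Ls"
    and "smooth_conic C1" and "smooth_conic C2" and "C1 \<noteq> C2"
    and "p \<noteq> q" and "tangent_at C1 C2 p" and "tangent_at C1 C2 q"
    and "card Ls \<le> 2"
    and "x0 \<notin> S"
  shows "big (fundamental_group (UNIV - S) x0)"
proof -
  obtain A B where "smooth_conic_equation A C1" "smooth_conic_equation B C2"
    using assms(3,4) unfolding smooth_conic_def by blast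
  moreover have "finite Ls" "\<And>L. L \<in> Ls \<Longrightarrow> \<exists>a. a \<noteq> 0 \<and> L = zero_locus (linear_form a)"
    using assms(1) unfolding real_conic_line_arrangement_def real_line_def by blast+
  moreover note assms(10)[unfolded assms(2)]
  ultimately show ?thesis
    unfolding assms(2) by (rule big_bitangent_conics_lines[OF _ _ assms(5-8)])
qed

end
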